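(* Let $d\in\mathbb{N}$ be fixed and, for each $n\in\mathbb{N}$, let $\varepsilon_n>0$, $y_n\in\mathbb{R}^d$ and $\Phi_n,R_n,I_n,\hat x_n,\Sigma_n,\mu^{y_n},\mathcal{L}_{\mu^{y_n}}$ be as in the context. Suppose that for every $n\in\mathbb{N}$: (1) $\Phi_n,R_n\in C^3(\mathbb{R}^d,\mathbb{R})$, $I_n$ has a unique global minimizer $\hat x_n\in\mathbb{R}^d$, and $D^2I_n(\hat x_n)$ is positive definite; (2) $K_n>0$ is a constant such that $\max\{\|D^3\Phi_n(x)\|_{\Sigma_n},\|D^3R_n(x)\|_{\Sigma_n}\}\le K_n$ for all $x\in\mathbb{R}^d$; (3) $0<\delta_n\le1$ is such that $I_n(x)\ge\frac{\delta_n}{2}\|x-\hat x_n\|_{\Sigma_n}^2$ for all $x\in\mathbb{R}^d$. If $\varepsilon_n^{1/2}K_n\to0$ as $n\to\infty$ and if there exist $\underline\delta>0$ and $N_0\in\mathbb{N}$ such that $\delta_n\ge\underline\delta$ and $\varepsilon_n\le1$ for all $n\ge N_0$, then there exist a constant $C=C(d)>0$ (depending on $d$) and $N_1\ge N_0$ such that $$d_{\mathrm{TV}}(\mu^{y_n},\mathcal{L}_{\mu^{y_n}})\le C\,\varepsilon_n^{1/2}K_n\qquad\text{for all }n\ge N_1.$$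
   Context: Let $|\cdot|$ be the Euclidean norm on $\mathbb{R}^d$. For each $n$ let $G_n:\mathbb{R}^d\to\mathbb{R}^d$ be a map, $y_n\in\mathbb{R}^d$, $\varepsilon_n>0$, and $R_n:\mathbb{R}^d\to\mathbb{R}$ such that $\exp(-R_n(x))$ is the Lebesgue density of a probability measure (the prior). Put $\Phi_n(x):=\frac12|y_n-G_n(x)|^2$. Let $\hat x_n$ be the unique minimizer of $\Phi_n+\varepsilon_nR_n$ and $I_n(x):=\Phi_n(x)+\varepsilon_nR_n(x)-\Phi_n(\hat x_n)-\varepsilon_nR_n(\hat x_n)$. The posterior $\mu^{y_n}$ is the probability measure with Lebesgue density proportional to $\exp(-\frac1{\varepsilon_n}I_n(x))$. Put $\Sigma_n:=(D^2I_n(\hat x_n))^{-1}$ (inverse Hessian) and $\mathcal{L}_{\mu^{y_n}}:=\mathcal{N}(\hat x_n,\varepsilon_n\Sigma_n)$ (the Laplace approximation). For symmetric positive definite $\Sigma$, $\|x\|_\Sigma:=|\Sigma^{-1/2}x|$, and for $g\in C^3(\mathbb{R}^d,\mathbb{R})$, $\|D^3g(x)\|_\Sigma:=\sup\{|D^3g(x)(h_1,h_2,h_3)|:\|h_1\|_\Sigma,\|h_2\|_\Sigma,\|h_3\|_\Sigma\le1\}$. Total variation distance: $d_{\mathrm{TV}}(\nu,\mu):=\sup_{A\in\mathcal{B}(\mathbb{R}^d)}|\nu(A)-\mu(A)|$. *)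

theory Defs
  imports "HOL-Probability.Probability"
begin

section \<open>Derivatives of real-valued functions\<close>

text \<open>
  \<open>iter_deriv [h\<^sub>1, \<dots>, h\<^sub>k] f x\<close> is \<open>D\<^sup>k f(x)(h\<^sub>1, \<dots>, h\<^sub>k)\<close>, obtained by differentiating
  in the directions \<open>h\<^sub>1\<close>, \<open>h\<^sub>2\<close>, \dots in turn. It is meaningful for \<open>f\<close> of class \<open>C\<^sup>k\<close>.
\<close>

primrec iter_deriv :: "'a list \<Rightarrow> ('a::real_normed_vector \<Rightarrow> real) \<Rightarrow> 'a \<Rightarrow> real" where
  "iter_deriv [] f = f"
| "iter_deriv (h # hs) f = iter_deriv hs (\<lambda>x. frechet_derivative f (at x) h)"

text \<open>
  Class \<open>C\<^sup>k\<close> on the whole space. Since the domain is finite-dimensional, the derivative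
  \<open>x \<mapsto> Df(x)\<close> is of class \<open>C\<^sup>k\<close> for the operator norm iff \<open>x \<mapsto> Df(x) h\<close> is of class \<open>C\<^sup>k\<close>
  for every direction \<open>h\<close>.
\<close>

primrec C_class :: "nat \<Rightarrow> ('a::euclidean_space \<Rightarrow> real) \<Rightarrow> bool" where
  "C_class 0 f \<longleftrightarrow> continuous_on UNIV f"
| "C_class (Suc k) f \<longleftrightarrow>
     (\<forall>x. f differentiable (at x)) \<and> (\<forall>h. C_class k (\<lambda>x. frechet_derivative f (at x) h))"

definition hessian :: "(real^'d \<Rightarrow> real) \<Rightarrow> real^'d \<Rightarrow> real^'d^'d" where
  "hessian f x = (\<chi> i j. iter_deriv [axis i 1, axis j 1] f x)"

section \<open>Symmetric positive definite matrices and weighted norms\<close>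

definition sym_pos_def :: "real^'d^'d \<Rightarrow> bool" where
  "sym_pos_def A \<longleftrightarrow> transpose A = A \<and> (\<forall>x. x \<noteq> 0 \<longrightarrow> 0 < x \<bullet> (A *v x))"

text \<open>The principal square root; it exists and is unique if \<open>A\<close> is symmetric positive definite.\<close>

definition mat_sqrt :: "real^'d^'d \<Rightarrow> real^'d^'d" where
  "mat_sqrt A = (THE B. sym_pos_def B \<and> B ** B = A)"

definition wnorm :: "real^'d^'d \<Rightarrow> real^'d \<Rightarrow> real" where
  "wnorm \<Sigma> x = norm (matrix_inv (mat_sqrt \<Sigma>) *v x)"

text \<open>
  For \<open>g\<close> of class \<open>C\<^sup>3\<close> and symmetric positive definite \<open>\<Sigma>\<close>, the supremum is over a bounded
  set of reals, because \<open>D\<^sup>3 g(x)\<close> is a trilinear form on a finite-dimensional space.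
\<close>

definition D3_wnorm :: "real^'d^'d \<Rightarrow> (real^'d \<Rightarrow> real) \<Rightarrow> real^'d \<Rightarrow> real" where
  "D3_wnorm \<Sigma> g x = Sup {\<bar>iter_deriv [h\<^sub>1, h\<^sub>2, h\<^sub>3] g x\<bar> | h\<^sub>1 h\<^sub>2 h\<^sub>3.
      wnorm \<Sigma> h\<^sub>1 \<le> 1 \<and> wnorm \<Sigma> h\<^sub>2 \<le> 1 \<and> wnorm \<Sigma> h\<^sub>3 \<le> 1}"

section \<open>Bayesian inverse problem, posterior and Laplace approximation\<close>

definition unique_minimizer :: "('a \<Rightarrow> real) \<Rightarrow> 'a \<Rightarrow> bool" where
  "unique_minimizer f z \<longleftrightarrow>
     is_arg_min f (\<lambda>_. True) z \<and> (\<forall>w. is_arg_min f (\<lambda>_. True) w \<longrightarrow> w = z)"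

definition misfit :: "(real^'d \<Rightarrow> real^'d) \<Rightarrow> real^'d \<Rightarrow> real^'d \<Rightarrow> real" where
  "misfit G y x = 1/2 * (norm (y - G x))\<^sup>2"

definition shifted_objective ::
    "real \<Rightarrow> ('a \<Rightarrow> real) \<Rightarrow> ('a \<Rightarrow> real) \<Rightarrow> 'a \<Rightarrow> 'a \<Rightarrow> real" where
  "shifted_objective \<epsilon> \<Phi> R z x = \<Phi> x + \<epsilon> * R x - \<Phi> z - \<epsilon> * R z"

definition is_prior_potential :: "(real^'d \<Rightarrow> real) \<Rightarrow> bool" where
  "is_prior_potential R \<longleftrightarrow> prob_space (density lborel (\<lambda>x. ennreal (exp (- R x))))"

definition posterior :: "real \<Rightarrow> (real^'d \<Rightarrow> real) \<Rightarrow> (real^'d) measure" where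
  "posterior \<epsilon> I = density lborel
     (\<lambda>x. ennreal (exp (- (1/\<epsilon>) * I x) / (LINT z|lborel. exp (- (1/\<epsilon>) * I z))))"

text \<open>Used only for symmetric positive definite covariance \<open>S\<close>.\<close>

definition gaussian :: "real^'d \<Rightarrow> real^'d^'d \<Rightarrow> (real^'d) measure" where
  "gaussian m S = density lborel
     (\<lambda>x. ennreal (exp (- (1/2) * ((x - m) \<bullet> (matrix_inv S *v (x - m))))
                   / sqrt ((2 * pi) ^ CARD('d) * det S)))"

definition tv_dist :: "'a::topological_space measure \<Rightarrow> 'a measure \<Rightarrow> real" where
  "tv_dist \<nu> \<mu> = (SUP A \<in> sets borel. \<bar>measure \<nu> A - measure \<mu> A\<bar>)"

end

theory Submission
  imports Defs
begin

text \<open>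
  Rescale by \<open>u = (\<epsilon> \<Sigma>)\<^sup>-\<^sup>1\<^sup>/\<^sup>2 (x - z)\<close>, where \<open>z\<close> is the minimizer, and put \<open>t = \<epsilon>\<^sup>1\<^sup>/\<^sup>2 K\<close>. Taylor's formula
  gives \<open>|I/\<epsilon> - |u|\<^sup>2/2| \<le> t |u|\<^sup>3 / 3\<close>, so with \<open>I/\<epsilon> \<ge> \<delta>\<^sub>0 |u|\<^sup>2 / 2\<close> the unnormalized densities differ by at most
  \<open>(t/3) |u|\<^sup>3 exp(-|u|\<^sup>2/4) + (16/9) t\<^sup>2 |u|\<^sup>2 exp(-\<delta>\<^sub>0 |u|\<^sup>2/2)\<close>. The integral of the first term is \<open>t\<close> times a
  constant depending only on the dimension. The constant of the second one depends on \<open>\<delta>\<^sub>0\<close>, but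
  the factor \<open>t\<^sup>2\<close> makes it at most \<open>t\<close> eventually. Hence \<open>C\<close> does not depend on \<open>\<delta>\<^sub>0\<close>.
\<close>

section \<open>Symmetric positive definite matrices\<close>

text \<open>Since \<open>\<Sigma>\<close> is the inverse Hessian at the minimizer, the second-order
  Taylor term of \<open>I\<close> is exactly half the squared weighted norm, that is,
  \<open>\<epsilon>\<close> times the Gaussian exponent; only the cubic remainder separates the two
  densities. Its constant comes from |D^3 I| \<le> K + \<epsilon> K \<le> 2 K, divided by 3!. The
  obstacle is that the cubic bound says nothing useful far out, where it exceeds |u|^2/2. The cut is
  at t |u| = 3/4, where it equals |u|^2/4: inside, the exponent keeps half of its size without any
  help from \<open>\<delta>\<close>; outside, only the quadratic lower bound gives decay, so this is
  the one place where \<open>\<delta>\<close> enters a constant. The total variation bound divides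
  by the Gaussian normalizing constant alone. Its factor sqrt (det) cancels against the Jacobian of
  the rescaling, which leaves (2 pi)^(d/2). The weighted norm is built on a square root given by a
  definite description, so every fact about it rests on unique existence of that root. This is why a
  spectral theorem comes first; the same diagonalization later yields the Jacobian.\<close>

lemma selfadjoint_eigenvector:
  fixes f :: "'a::euclidean_space \<Rightarrow> 'a"
  assumes lin: "linear f" and sa: "\<And>x y. x \<bullet> f y = f x \<bullet> y"
    and S: "subspace S" "f ` S \<subseteq> S" "S \<noteq> {0}"
  obtains v c where "v \<in> S" "norm v = 1" "f v = c *\<^sub>R v"
proof -
  let ?K = "S \<inter> sphere 0 1"
  obtain w where w: "w \<in> S" "w \<noteq> 0"
    using S subspace_0 by blast
  have "compact ?K"
    using S(1) by (simp add: closed_Int_compact closed_subspace)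
  moreover have "w /\<^sub>R norm w \<in> ?K"
    using w S(1) by (simp add: subspace_scale)
  moreover have cont: "continuous_on ?K (\<lambda>x. x \<bullet> f x)"
    by (intro continuous_intros linear_continuous_on linear_conv_bounded_linear[THEN iffD1] lin)
  \<comment> \<open>The maximizer of the Rayleigh quotient is the eigenvector, its value
    \<open>c\<close> the eigenvalue: \<open>g = c - f\<close> is nonnegative as a quadratic form on
    \<open>S\<close> and vanishes at \<open>v\<close>, which forces \<open>g v = 0\<close>.\<close>
  ultimately obtain v where v: "v \<in> ?K" and max: "\<And>x. x \<in> ?K \<Longrightarrow> x \<bullet> f x \<le> v \<bullet> f v"
    using continuous_attains_sup[of ?K "\<lambda>x. x \<bullet> f x"] by blast
  define c where "c = v \<bullet> f v"
  define g where "g x = c *\<^sub>R x - f x" for x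
  interpret f: linear f by fact
  have nonneg: "0 \<le> x \<bullet> g x" if "x \<in> S" for x
  proof (cases "x = 0")
    case False
    have "x /\<^sub>R norm x \<in> ?K"
      using that False S(1) by (simp add: subspace_scale)
    from max[OF this] have "(x \<bullet> f x) / (norm x)\<^sup>2 \<le> c"
      by (simp add: f.scaleR c_def power2_eq_square field_simps)
    with False have "x \<bullet> f x \<le> c * (norm x)\<^sup>2"
      by (simp add: divide_simps)
    then show ?thesis
      by (simp add: g_def inner_diff_right power2_norm_eq_inner)
  qed simp
  have "g v \<in> S"
    unfolding g_def using v S by (intro subspace_diff subspace_scale) auto
  have sym: "x \<bullet> g y = g x \<bullet> y" for x y
    by (simp add: g_def inner_diff_right inner_diff_left sa)
  have zero: "v \<bullet> g v = 0"
    using v by (simp add: g_def c_def inner_diff_right dot_square_norm)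
  have "g v \<bullet> g v = 0"
  proof (rule ccontr)
    define a b where "a = g v \<bullet> g v" and "b = g v \<bullet> g (g v)"
    assume "g v \<bullet> g v \<noteq> 0"
    then have a: "a > 0"
      by (simp add: a_def)
    have glin: "g (x + r *\<^sub>R y) = g x + r *\<^sub>R g y" for x y r
      by (simp add: g_def f.add f.scaleR algebra_simps)
    have ex: "(v + r *\<^sub>R g v) \<bullet> g (v + r *\<^sub>R g v) = 2 * r * a + r\<^sup>2 * b" for r
      using zero sym[of v "g v"]
      by (simp add: glin inner_add_left inner_add_right a_def b_def power2_eq_square algebra_simps)
    have pos: "0 \<le> 2 * r * a + r\<^sup>2 * b" for r
      unfolding ex[symmetric] using v \<open>g v \<in> S\<close> S(1)
      by (intro nonneg subspace_add subspace_scale) auto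
    have b: "b \<ge> 0"
      unfolding b_def using nonneg \<open>g v \<in> S\<close> by blast
    \<comment> \<open>Moving from \<open>v\<close> against \<open>g v\<close> makes the form
      negative to first order. The minimizing step would be \<open>- a / b\<close>; the denominator
      \<open>b + 1\<close> also covers \<open>b = 0\<close>.\<close>
    define r where "r = - a / (b + 1)"
    have "2 * r * a + r\<^sup>2 * b = (a / (b+1))\<^sup>2 * (b - 2 * (b + 1))"
    proof -
      have "b + 1 \<noteq> 0"
        using b by simp
      then have "a = - r * (b + 1)" "(a / (b+1))\<^sup>2 = r\<^sup>2"
        by (simp_all add: r_def power_divide)
      then have "2 * r * a = r\<^sup>2 * (- 2 * (b + 1))"
        by (simp only: power2_eq_square)
      with \<open>(a / (b+1))\<^sup>2 = r\<^sup>2\<close> show ?thesis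
        by (simp add: distrib_left right_diff_distrib)
    qed
    also have "\<dots> < 0"
      using a b by (intro mult_pos_neg) auto
    finally show False
      using pos[of r] by simp
  qed
  then have "f v = c *\<^sub>R v"
    by (simp add: g_def)
  with v that show thesis by auto
qed

text \<open>Split off a unit eigenvector \<open>v\<close> and continue in its orthogonal complement
  within \<open>S\<close>, which is again invariant because
  \<open>v \<bullet> f x = f v \<bullet> x\<close>, a multiple of \<open>v \<bullet> x\<close>. The
  invariant subspace \<open>S\<close> is a parameter for the sake of this induction.\<close>

lemma selfadjoint_orthonormal_eigenbasis:
  fixes f :: "'a::euclidean_space \<Rightarrow> 'a"
  assumes lin: "linear f" and sa: "\<And>x y. x \<bullet> f y = f x \<bullet> y"
    and S: "subspace S" "f ` S \<subseteq> S"
  shows "\<exists>B\<subseteq>S. pairwise orthogonal B \<and> (\<forall>b\<in>B. norm b = 1 \<and> (\<exists>c. f b = c *\<^sub>R b)) \<and> span B = S"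
  using S
proof (induction "dim S" arbitrary: S rule: less_induct)
  case less
  show ?case
  proof (cases "S = {0}")
    case True
    then show ?thesis
      by (intro exI[of _ "{}"]) auto
  next
    case False
    then obtain v c where v: "v \<in> S" "norm v = 1" "f v = c *\<^sub>R v"
      using selfadjoint_eigenvector[OF lin sa less.prems False] by blast
    define T where "T = S \<inter> {x. v \<bullet> x = 0}"
    have subT: "subspace T"
      unfolding T_def using less.prems(1) subspace_hyperplane by (rule subspace_inter)
    have fT: "f ` T \<subseteq> T"
      using less.prems(2) v(3) by (auto simp: T_def sa)
    have "v \<notin> T"
      using v by (auto simp: T_def)
    then have "T \<subset> S"
      using v(1) unfolding T_def by blast
    then have "dim T < dim S"
      using dim_psubset subT less.prems(1) by (metis span_eq_iff)
    then obtain B where B: "B \<subseteq> T" "pairwise orthogonal B"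
        "\<And>b. b \<in> B \<Longrightarrow> norm b = 1 \<and> (\<exists>c. f b = c *\<^sub>R b)" "span B = T"
      using less.hyps[OF _ subT fT] by metis
    have "span (insert v B) = S"
    proof
      show "span (insert v B) \<subseteq> S"
        using B(1) v(1) less.prems(1) by (intro span_minimal) (auto simp: T_def)
      show "S \<subseteq> span (insert v B)"
      proof
        fix x assume x: "x \<in> S"
        have "x - (v \<bullet> x) *\<^sub>R v \<in> T"
          using x v less.prems(1)
          by (auto simp: T_def inner_diff_right dot_square_norm subspace_diff subspace_scale)
        then show "x \<in> span (insert v B)"
          unfolding span_insert B(4) by blast
      qed
    qed
    moreover have "pairwise orthogonal (insert v B)"
      using B by (auto simp: pairwise_insert T_def orthogonal_def inner_commute)
    ultimately show ?thesis
      using B v by (intro exI[of _ "insert v B"]) (auto simp: T_def)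
  qed
qed

section \<open>Orthogonal diagonalization of matrices\<close>

definition diag_mat :: "('n \<Rightarrow> real) \<Rightarrow> real^'n^'n" where
  "diag_mat c = (\<chi> i j. if i = j then c i else 0)"

lemma diag_mat_mult_vec: "diag_mat c *v x = (\<chi> i. c i * x $ i)"
  by (simp add: diag_mat_def matrix_vector_mult_def vec_eq_iff if_distrib[of "\<lambda>z. z * _"] cong: if_cong)

lemma diag_mat_mult_axis: "diag_mat c *v axis j 1 = c j *\<^sub>R axis j 1"
  by (auto simp: diag_mat_mult_vec vec_eq_iff axis_def)

lemma matrix_eqI_axis:
  fixes A B :: "real^'n^'m"
  assumes "\<And>j. A *v axis j 1 = B *v axis j 1"
  shows "A = B"
  using assms by (simp add: matrix_vector_mult_basis column_def vec_eq_iff)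

lemma diag_mat_mult: "diag_mat c ** diag_mat d = diag_mat (\<lambda>i. c i * d i)"
  by (simp add: matrix_eq diag_mat_mult_vec matrix_vector_mul_assoc[symmetric] vec_eq_iff mult_ac)

lemma transpose_diag_mat [simp]: "transpose (diag_mat c) = diag_mat c"
  by (auto simp: diag_mat_def transpose_def vec_eq_iff)

lemma det_diag_mat: "det (diag_mat c) = (\<Prod>i\<in>UNIV. c i)"
  by (subst det_diagonal) (auto simp: diag_mat_def)

lemma transpose_inner: "x \<bullet> (A *v y) = (transpose A *v x) \<bullet> y" for A :: "real^'n^'m"
  by (simp add: dot_lmul_matrix)

text \<open>An orthonormal eigenbasis has exactly \<open>CARD('n)\<close> elements, so a bijection
  \<open>g\<close> indexes it by \<open>'n\<close> and its members become the columns of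
  \<open>P\<close>. Then \<open>A ** P = P ** diag_mat c\<close> is the eigenvalue equation column
  by column.\<close>

lemma symmetric_matrix_diagonalize:
  fixes A :: "real^'n^'n"
  assumes "transpose A = A"
  shows "\<exists>P c. orthogonal_matrix P \<and> A = P ** diag_mat c ** transpose P"
proof -
  have sa: "x \<bullet> (A *v y) = (A *v x) \<bullet> y" for x y
    using transpose_inner[of x A y] assms by simp
  obtain B where B: "pairwise orthogonal B" "\<And>b. b \<in> B \<Longrightarrow> norm b = 1"
     "\<And>b. b \<in> B \<Longrightarrow> \<exists>c. A *v b = c *\<^sub>R b" "span B = UNIV"
    using selfadjoint_orthonormal_eigenbasis[of "(*v) A" UNIV] sa by auto
  have "0 \<notin> B"
    using B(2) by fastforce
  then have "independent B"
    using B(1) by (simp add: pairwise_orthogonal_independent)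
  then have "card B = CARD('n)" "finite B"
    using B(4) by (auto simp: dim_eq_card[of B UNIV, symmetric] independent_imp_finite)
  then obtain g where g: "bij_betw g (UNIV :: 'n set) B"
    using finite_same_card_bij[of "UNIV :: 'n set" B] by auto
  have gB: "g i \<in> B" for i
    using g by (auto simp: bij_betw_def)
  obtain c where c: "A *v g i = c i *\<^sub>R g i" for i
    using B(3)[OF gB] by metis
  define P :: "real^'n^'n" where "P = (\<chi> i j. g j $ i)"
  have col: "column j P = g j" for j
    by (simp add: P_def column_def)
  have P: "orthogonal_matrix P"
    unfolding orthogonal_matrix_orthonormal_columns col
  proof safe
    show "norm (g i) = 1" for i
      using B(2) gB by blast
    show "orthogonal (g i) (g j)" if "i \<noteq> j" for i j
      using B(1) gB g that unfolding pairwise_def bij_betw_def inj_on_def by blast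
  qed
  have "(A ** P) *v axis j 1 = (P ** diag_mat c) *v axis j 1" for j
    unfolding matrix_vector_mul_assoc[symmetric] diag_mat_mult_axis matrix_vector_mult_scaleR
    by (simp add: matrix_vector_mult_basis col c)
  then have "A ** P = P ** diag_mat c"
    by (rule matrix_eqI_axis)
  then have "P ** diag_mat c ** transpose P = A ** (P ** transpose P)"
    by (simp add: matrix_mul_assoc)
  then have AP: "A = P ** diag_mat c ** transpose P"
    using P by (simp add: orthogonal_matrix_def)
  show ?thesis
    by (intro exI conjI) (rule P, rule AP)
qed

lemma sym_pos_def_diagonalize:
  fixes A :: "real^'n^'n"
  assumes "sym_pos_def A"
  shows "\<exists>P c. orthogonal_matrix P \<and> (\<forall>i. c i > 0) \<and> A = P ** diag_mat c ** transpose P"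
proof -
  obtain P c where P: "orthogonal_matrix P" "A = P ** diag_mat c ** transpose P"
    using assms symmetric_matrix_diagonalize[of A] unfolding sym_pos_def_def by blast
  have PP: "transpose P ** P = mat 1"
    using P(1) by (simp add: orthogonal_matrix)
  have cpos: "c i > 0" for i
  proof -
    \<comment> \<open>The quadratic form of \<open>A\<close> at its \<open>i\<close>-th eigenvector
      is the eigenvalue \<open>c i\<close>.\<close>
    define x where "x = P *v axis i 1"
    have tx: "transpose P *v x = axis i 1"
      using PP by (simp add: x_def matrix_vector_mul_assoc)
    then have "x \<noteq> 0"
      by auto
    then have "0 < x \<bullet> (A *v x)"
      using assms by (simp add: sym_pos_def_def)
    also have "x \<bullet> (A *v x) = axis i 1 \<bullet> (diag_mat c *v axis i 1)"
      by (simp only: P(2) matrix_vector_mul_assoc[symmetric] tx transpose_inner[of x P])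
    also have "\<dots> = c i"
      by (simp add: diag_mat_mult_vec inner_axis' )
    finally show ?thesis .
  qed
  show ?thesis
    by (intro exI conjI allI) (rule P(1), rule cpos, rule P(2))
qed

lemma sym_pos_def_conj_diag:
  fixes P :: "real^'n^'n"
  assumes P: "orthogonal_matrix P" and c: "\<And>i. c i > 0"
  shows "sym_pos_def (P ** diag_mat c ** transpose P)"
  unfolding sym_pos_def_def
proof safe
  show "transpose (P ** diag_mat c ** transpose P) = P ** diag_mat c ** transpose P"
    by (simp add: matrix_transpose_mul matrix_mul_assoc)
  fix x :: "real^'n" assume x: "x \<noteq> 0"
  define z where "z = transpose P *v x"
  have "P *v z = x"
    using P by (simp only: z_def matrix_vector_mul_assoc orthogonal_matrix_def matrix_vector_mul_lid)
  with x have "z \<noteq> 0"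
    by auto
  then obtain i where "z $ i \<noteq> 0"
    by (auto simp: vec_eq_iff)
  then have "0 < (\<Sum>i\<in>UNIV. c i * (z $ i)\<^sup>2)"
    using c by (intro sum_pos2[of _ i]) (auto simp: less_imp_le)
  also have "\<dots> = x \<bullet> ((P ** diag_mat c ** transpose P) *v x)"
    by (simp only: matrix_vector_mul_assoc[symmetric] transpose_inner[of x P] z_def[symmetric])
      (simp add: diag_mat_mult_vec inner_vec_def power2_eq_square mult_ac)
  finally show "0 < x \<bullet> ((P ** diag_mat c ** transpose P) *v x)" .
qed

section \<open>Principal square roots, inverses and determinants\<close>

lemma sym_pos_def_sqrt_exists:
  fixes A :: "real^'n^'n"
  assumes "sym_pos_def A"
  shows "\<exists>B. sym_pos_def B \<and> B ** B = A"
proof -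
  obtain P c where P: "orthogonal_matrix P" and c: "\<And>i. c i > 0" and A: "A = P ** diag_mat c ** transpose P"
    using sym_pos_def_diagonalize[OF assms] by (elim exE conjE) (rule that, auto)
  define B where "B = P ** diag_mat (\<lambda>i. sqrt (c i)) ** transpose P"
  have "B ** B = P ** diag_mat (\<lambda>i. sqrt (c i)) ** (transpose P ** P) ** diag_mat (\<lambda>i. sqrt (c i)) ** transpose P"
    by (simp only: B_def matrix_mul_assoc)
  also have "\<dots> = P ** (diag_mat (\<lambda>i. sqrt (c i)) ** diag_mat (\<lambda>i. sqrt (c i))) ** transpose P"
    using P by (simp add: orthogonal_matrix matrix_mul_assoc)
  also have "\<dots> = A"
    using c by (simp add: diag_mat_mult A less_imp_le)
  finally have "B ** B = A" .
  moreover have "sym_pos_def B"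
    unfolding B_def by (rule sym_pos_def_conj_diag[OF P]) (simp add: c)
  ultimately show ?thesis
    by (intro exI[of _ B] conjI)
qed

text \<open>If \<open>B\<^sup>2 = C\<^sup>2\<close> and \<open>C v = c v\<close> then \<open>(B + c)(B - c) v = 0\<close>, and \<open>B + c\<close> is positive definite.\<close>

lemma sym_pos_def_sqrt_unique:
  fixes B C :: "real^'n^'n"
  assumes B: "sym_pos_def B" and C: "sym_pos_def C" and eq: "B ** B = C ** C"
  shows "B = C"
proof -
  obtain P c where P: "orthogonal_matrix P" and c: "\<And>i. c i > 0" and CP: "C = P ** diag_mat c ** transpose P"
    using sym_pos_def_diagonalize[OF C] by (elim exE conjE) (rule that, auto)
  have "C ** P = P ** diag_mat c"
    using P by (simp add: CP orthogonal_matrix matrix_mul_assoc[symmetric])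
  then have Cv: "C *v (P *v axis j 1) = c j *\<^sub>R (P *v axis j 1)" for j
    by (simp add: matrix_vector_mul_assoc)
       (simp add: matrix_vector_mul_assoc[symmetric] diag_mat_mult_axis matrix_vector_mult_scaleR)
  have "B *v (P *v axis j 1) = C *v (P *v axis j 1)" for j
  proof -
    define v where "v = P *v axis j 1"
    define w where "w = B *v v - c j *\<^sub>R v"
    have "B *v w + c j *\<^sub>R w = (B ** B) *v v - (c j * c j) *\<^sub>R v"
      by (simp add: w_def matrix_vector_mult_diff_distrib matrix_vector_mult_scaleR
          matrix_vector_mul_assoc[symmetric] scaleR_diff_right)
    also have "\<dots> = 0"
      using Cv[of j] by (simp add: eq v_def[symmetric] matrix_vector_mul_assoc[symmetric] matrix_vector_mult_scaleR)
    finally have "w \<bullet> (B *v w) + c j * (w \<bullet> w) = 0"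
      by (metis inner_add_right inner_scaleR_right inner_zero_right)
    moreover have "w \<noteq> 0 \<Longrightarrow> 0 < w \<bullet> (B *v w)" "0 \<le> c j * (w \<bullet> w)"
      using B c[of j] by (auto simp: sym_pos_def_def)
    ultimately have "w = 0"
      by fastforce
    then show ?thesis
      using Cv[of j] by (simp add: w_def v_def)
  qed
  then have "B ** P = C ** P"
    by (intro matrix_eqI_axis) (simp add: matrix_vector_mul_assoc[symmetric])
  then have "B ** (P ** transpose P) = C ** (P ** transpose P)"
    by (simp add: matrix_mul_assoc)
  then show ?thesis
    using P by (simp add: orthogonal_matrix_def)
qed

text \<open>Unique existence gives the description in \<open>mat_sqrt\<close> its meaning. All later
  arguments know the root only through these two properties.\<close>

lemma mat_sqrt_sym_pos_def:
  assumes "sym_pos_def A"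
  shows "sym_pos_def (mat_sqrt A)" "mat_sqrt A ** mat_sqrt A = A"
proof -
  have "\<exists>!B. sym_pos_def B \<and> B ** B = A"
    using sym_pos_def_sqrt_exists[OF assms]
    by (rule ex_ex1I) (auto intro: sym_pos_def_sqrt_unique)
  from theI'[OF this] show "sym_pos_def (mat_sqrt A)" "mat_sqrt A ** mat_sqrt A = A"
    by (simp_all add: mat_sqrt_def)
qed

text \<open>\<open>matrix_inv\<close> is a choice among two-sided inverses; for square matrices a
  right inverse already determines it.\<close>

lemma matrix_inv_eqI:
  fixes A B :: "real^'n^'n"
  assumes "A ** B = mat 1"
  shows "matrix_inv A = B"
proof -
  have BA: "B ** A = mat 1"
    using assms matrix_left_right_inverse by blast
  have inv: "A ** matrix_inv A = mat 1 \<and> matrix_inv A ** A = mat 1"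
    unfolding matrix_inv_def by (rule someI[of _ B]) (use assms BA in auto)
  have "matrix_inv A = B ** (A ** matrix_inv A)"
    by (simp add: matrix_mul_assoc BA)
  with inv show ?thesis
    by simp
qed

lemma sym_pos_def_inverse:
  fixes A :: "real^'n^'n"
  assumes A: "sym_pos_def A"
  shows "A ** matrix_inv A = mat 1" "matrix_inv A ** A = mat 1" "sym_pos_def (matrix_inv A)"
proof -
  obtain P c where P: "orthogonal_matrix P" and c: "\<And>i. c i > 0" and A: "A = P ** diag_mat c ** transpose P"
    using sym_pos_def_diagonalize[OF A] by (elim exE conjE) (rule that, auto)
  define B where "B = P ** diag_mat (\<lambda>i. inverse (c i)) ** transpose P"
  have "A ** B = P ** diag_mat c ** (transpose P ** P) ** diag_mat (\<lambda>i. inverse (c i)) ** transpose P"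
    by (simp only: A B_def matrix_mul_assoc)
  also have "\<dots> = P ** (diag_mat c ** diag_mat (\<lambda>i. inverse (c i))) ** transpose P"
    using P by (simp add: orthogonal_matrix matrix_mul_assoc)
  also have "diag_mat c ** diag_mat (\<lambda>i. inverse (c i)) = mat 1"
    using c by (simp add: diag_mat_mult less_imp_neq[symmetric]) (simp add: diag_mat_def mat_def)
  finally have AB: "A ** B = mat 1"
    using P by (simp add: orthogonal_matrix_def)
  then have inv: "matrix_inv A = B"
    by (rule matrix_inv_eqI)
  show "A ** matrix_inv A = mat 1"
    unfolding inv by (rule AB)
  then show "matrix_inv A ** A = mat 1"
    using matrix_left_right_inverse by blast
  show "sym_pos_def (matrix_inv A)"
    unfolding inv B_def by (rule sym_pos_def_conj_diag[OF P]) (simp add: c)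
qed

lemma det_sym_pos_def:
  fixes A :: "real^'n^'n"
  assumes A: "sym_pos_def A"
  shows "det A > 0"
proof -
  obtain P c where P: "orthogonal_matrix P" and c: "\<And>i. c i > 0" and A: "A = P ** diag_mat c ** transpose P"
    using sym_pos_def_diagonalize[OF A] by (elim exE conjE) (rule that, auto)
  have "det P * det P = 1"
    using det_orthogonal_matrix[OF P] by auto
  moreover have "det A = (det P * det P) * (\<Prod>i\<in>UNIV. c i)"
    unfolding A det_mul det_transpose det_diag_mat by (simp only: mult_ac)
  ultimately show ?thesis
    using c by (simp add: prod_pos)
qed

text \<open>Removes the square root: the weighted norm becomes the quadratic form that occurs both
  in the Gaussian density and, as \<open>matrix_inv \<Sigma>\<close> is the Hessian, in the Taylor
  expansion.\<close>

lemma wnorm_squared: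
  fixes \<Sigma> :: "real^'n^'n"
  assumes "sym_pos_def \<Sigma>"
  shows "(wnorm \<Sigma> x)\<^sup>2 = x \<bullet> (matrix_inv \<Sigma> *v x)"
proof -
  define S where "S = mat_sqrt \<Sigma>"
  have S: "sym_pos_def S" "S ** S = \<Sigma>"
    using mat_sqrt_sym_pos_def[OF assms] by (auto simp: S_def)
  define T where "T = matrix_inv S"
  have T: "S ** T = mat 1" "T ** S = mat 1" "transpose T = T"
    using sym_pos_def_inverse[OF S(1)] by (auto simp: T_def sym_pos_def_def)
  have "\<Sigma> ** (T ** T) = S ** (S ** T) ** T"
    by (simp only: S(2)[symmetric] matrix_mul_assoc)
  then have "matrix_inv \<Sigma> = T ** T"
    using T by (intro matrix_inv_eqI) simp
  then show ?thesis
    using transpose_inner[of x T "T *v x"] T(3)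
    by (simp add: wnorm_def power2_norm_eq_inner S_def[symmetric] T_def[symmetric]
        matrix_vector_mul_assoc[symmetric])
qed

section \<open>Linear substitutions and Gaussian integrals\<close>

lemma nn_integral_lborel_translate:
  fixes f :: "'a::euclidean_space \<Rightarrow> ennreal"
  assumes [measurable]: "f \<in> borel_measurable borel"
  shows "(\<integral>\<^sup>+x. f (x + a) \<partial>lborel) = (\<integral>\<^sup>+x. f x \<partial>lborel)"
proof -
  have "(\<integral>\<^sup>+x. f x \<partial>lborel) = (\<integral>\<^sup>+x. f x \<partial>distr lborel borel ((+) a))"
    by (simp add: lborel_distr_plus)
  also have "\<dots> = (\<integral>\<^sup>+x. f (a + x) \<partial>lborel)"
    by (subst nn_integral_distr) auto
  finally show ?thesis
    by (simp add: add.commute)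
qed

text \<open>
  The change of variables formulas of HOL-Analysis require a well-ordered index type. The
  substitution \<open>x = S u\<close> is therefore derived from orthogonal invariance and a diagonal scaling.
  The image of Lebesgue measure under an invertible linear map is translation invariant;
  evaluating \<open>\<integral>\<integral> f (x + T y) g (T y) dx dy\<close> in both orders shows that it is a multiple of
  Lebesgue measure.
\<close>

lemma nn_integral_lborel_linear_swap:
  fixes f g :: "'a::euclidean_space \<Rightarrow> ennreal"
  assumes [measurable]: "f \<in> borel_measurable borel" "g \<in> borel_measurable borel"
    and T: "linear T" "surj T"
  shows "(\<integral>\<^sup>+x. f x \<partial>lborel) * (\<integral>\<^sup>+y. g (T y) \<partial>lborel) =
         (\<integral>\<^sup>+y. f (T y) \<partial>lborel) * (\<integral>\<^sup>+x. g (- x) \<partial>lborel)"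
proof -
  have T_meas [measurable]: "T \<in> borel_measurable borel"
    using T(1) by (intro borel_measurable_continuous_onI linear_continuous_on)
      (simp add: linear_conv_bounded_linear)
  \<comment> \<open>\<open>U x\<close> is a preimage of \<open>x\<close>. For fixed
    \<open>x\<close>, translating \<open>y\<close> by \<open>U x\<close> adds \<open>x\<close> to
    \<open>T y\<close>, and this moves \<open>x\<close> from the argument of \<open>f\<close> to
    that of \<open>g\<close>.\<close>
  obtain U where U: "T (U x) = x" for x
    using T(2) by (metis surjD)
  interpret T: linear T by fact
  have "(\<integral>\<^sup>+x. f x \<partial>lborel) * (\<integral>\<^sup>+y. g (T y) \<partial>lborel) =
        (\<integral>\<^sup>+y. (\<integral>\<^sup>+x. f (x + T y) * g (T y) \<partial>lborel) \<partial>lborel)"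
    by (simp add: nn_integral_multc nn_integral_lborel_translate nn_integral_cmult)
  also have "\<dots> = (\<integral>\<^sup>+x. (\<integral>\<^sup>+y. f (x + T y) * g (T y) \<partial>lborel) \<partial>lborel)"
    by (intro lborel_pair.Fubini') measurable
  also have "\<dots> = (\<integral>\<^sup>+x. (\<integral>\<^sup>+y. f (T y) * g (T y - x) \<partial>lborel) \<partial>lborel)"
  proof (rule nn_integral_cong)
    fix x
    have "(\<integral>\<^sup>+y. f (T y) * g (T y - x) \<partial>lborel) =
          (\<integral>\<^sup>+y. f (T (y + U x)) * g (T (y + U x) - x) \<partial>lborel)"
      by (subst nn_integral_lborel_translate[where a="U x", symmetric]) auto
    also have "\<dots> = (\<integral>\<^sup>+y. f (x + T y) * g (T y) \<partial>lborel)"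
      by (simp add: T.add U add.commute)
    finally show "(\<integral>\<^sup>+y. f (x + T y) * g (T y) \<partial>lborel) = (\<integral>\<^sup>+y. f (T y) * g (T y - x) \<partial>lborel)"
      by (rule sym)
  qed
  also have "\<dots> = (\<integral>\<^sup>+y. (\<integral>\<^sup>+x. f (T y) * g (T y - x) \<partial>lborel) \<partial>lborel)"
    by (intro lborel_pair.Fubini') measurable
  also have "\<dots> = (\<integral>\<^sup>+y. f (T y) * (\<integral>\<^sup>+x. g (- x) \<partial>lborel) \<partial>lborel)"
  proof (rule nn_integral_cong)
    fix y
    have "(\<integral>\<^sup>+x. g (T y - x) \<partial>lborel) = (\<integral>\<^sup>+x. g (T y - (x + T y)) \<partial>lborel)"
      by (subst nn_integral_lborel_translate[where a="T y", symmetric]) auto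
    then show "(\<integral>\<^sup>+x. f (T y) * g (T y - x) \<partial>lborel) = f (T y) * (\<integral>\<^sup>+x. g (- x) \<partial>lborel)"
      by (simp add: nn_integral_cmult)
  qed
  also have "\<dots> = (\<integral>\<^sup>+y. f (T y) \<partial>lborel) * (\<integral>\<^sup>+x. g (- x) \<partial>lborel)"
    by (simp add: nn_integral_multc)
  finally show ?thesis .
qed

lemma borel_measurable_matrix_vector_mult [measurable]:
  fixes A :: "real^'n^'m"
  assumes "f \<in> borel_measurable M"
  shows "(\<lambda>x. A *v f x) \<in> borel_measurable M"
  using measurable_compose[OF assms, of "(*v) A" borel]
    borel_measurable_continuous_onI[OF matrix_vector_mult_linear_continuous_on[of UNIV A]] by simp

text \<open>The proportionality factor is found by testing with the indicator of the unit ball,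
  which \<open>P\<close> and the reflection at the origin both preserve. Its volume is finite and
  positive, so it may be cancelled.\<close>

lemma nn_integral_lborel_orthogonal:
  fixes f :: "real^'n \<Rightarrow> ennreal"
  assumes [measurable]: "f \<in> borel_measurable borel" and P: "orthogonal_matrix P"
  shows "(\<integral>\<^sup>+x. f (P *v x) \<partial>lborel) = (\<integral>\<^sup>+x. f x \<partial>lborel)"
proof -
  let ?g = "indicator (cball 0 1) :: real^'n \<Rightarrow> ennreal"
  have norm_P: "norm (P *v x) = norm x" for x
    using P orthogonal_transformation_norm[of "(*v) P" x]
    by (simp add: orthogonal_transformation_matrix matrix_of_matrix_vector_mul)
  have "surj ((*v) P)"
    using P by (intro surjI[of _ "\<lambda>x. transpose P *v x"])
      (simp only: matrix_vector_mul_assoc orthogonal_matrix_def matrix_vector_mul_lid)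
  then have "(\<integral>\<^sup>+x. f x \<partial>lborel) * (\<integral>\<^sup>+y. ?g (P *v y) \<partial>lborel) =
        (\<integral>\<^sup>+y. f (P *v y) \<partial>lborel) * (\<integral>\<^sup>+x. ?g (- x) \<partial>lborel)"
    by (intro nn_integral_lborel_linear_swap) (auto intro!: borel_measurable_indicator)
  moreover have "?g (P *v y) = ?g y" "?g (- y) = ?g y" for y
    by (auto simp: indicator_def norm_P)
  ultimately have "(\<integral>\<^sup>+x. f x \<partial>lborel) * emeasure lborel (cball (0::real^'n) 1) =
        (\<integral>\<^sup>+y. f (P *v y) \<partial>lborel) * emeasure lborel (cball (0::real^'n) 1)"
    by simp
  moreover have "emeasure lborel (cball (0::real^'n) 1) \<noteq> \<infinity>"
    using emeasure_compact_finite[of "cball (0::real^'n) 1"] by auto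
  moreover have "emeasure lborel (cball (0::real^'n) 1) \<noteq> 0"
    using unit_ball_vol_pos[of "DIM(real^'n)"] by (simp add: emeasure_cball less_imp_neq[symmetric])
  ultimately show ?thesis
    by (simp add: ennreal_mult_cancel_left mult.commute[of _ "emeasure lborel (cball (0::real^'n) 1)"])
qed

lemma nn_integral_lborel_diag:
  fixes f :: "real^'n \<Rightarrow> ennreal"
  assumes [measurable]: "f \<in> borel_measurable borel" and c: "\<And>i. c i > 0"
  shows "(\<integral>\<^sup>+x. f x \<partial>lborel) = ennreal (\<Prod>i\<in>UNIV. c i) * (\<integral>\<^sup>+x. f (diag_mat c *v x) \<partial>lborel)"
proof -
  \<comment> \<open>The same factors as \<open>c\<close>, indexed by basis vectors instead of
    coordinates, as \<open>lborel_affine_euclidean\<close> expects them.\<close>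
  define c' where "c' b = (\<Sum>i\<in>UNIV. c i * b $ i)" for b :: "real^'n"
  have c': "c' (axis i 1) = c i" for i
    by (simp add: c'_def axis_def if_distrib cong: if_cong)
  have eq: "0 + (\<Sum>j\<in>Basis. (c' j * (x \<bullet> j)) *\<^sub>R j) = diag_mat c *v x" for x
  proof -
    have "(\<Sum>j\<in>Basis. (c' j * (x \<bullet> j)) *\<^sub>R j) = (\<Sum>i\<in>UNIV. (c i * x $ i) *\<^sub>R axis i 1)"
      unfolding Basis_vec_def
      by (subst sum.reindex_cong[of "\<lambda>i. axis i 1" UNIV]) (auto simp: inj_on_def axis_eq_axis c' inner_axis)
    also have "\<dots> = diag_mat c *v x"
      by (simp add: vec_eq_iff diag_mat_mult_vec axis_def if_distrib cong: if_cong)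
    finally show ?thesis by simp
  qed
  have prod: "(\<Prod>j\<in>(Basis::(real^'n) set). \<bar>c' j\<bar>) = (\<Prod>i\<in>UNIV. c i)"
    unfolding Basis_vec_def using c
    by (subst prod.reindex_cong[of "\<lambda>i. axis i 1" UNIV]) (auto simp: inj_on_def axis_eq_axis c' less_imp_le)
  have "c' j \<noteq> 0" if "j \<in> Basis" for j
    using that c c' by (auto simp: Basis_vec_def less_imp_neq[symmetric])
  from lborel_affine_euclidean[of c' 0, OF this, unfolded eq prod]
  have "(\<integral>\<^sup>+x. f x \<partial>lborel) = (\<integral>\<^sup>+x. f x \<partial>density (distr lborel borel ((*v) (diag_mat c))) (\<lambda>_. ennreal (\<Prod>i\<in>UNIV. c i)))"
    by simp
  also have "\<dots> = ennreal (\<Prod>i\<in>UNIV. c i) * (\<integral>\<^sup>+x. f (diag_mat c *v x) \<partial>lborel)"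
    by (simp add: nn_integral_density nn_integral_distr nn_integral_cmult)
  finally show ?thesis .
qed

text \<open>In \<open>P ** diag_mat c ** transpose P\<close> the outer factors preserve the integral
  and the middle one contributes the product of the eigenvalues, which is
  \<open>det S\<close>.\<close>

lemma nn_integral_lborel_sym_pos_def:
  fixes f :: "real^'n \<Rightarrow> ennreal"
  assumes f [measurable]: "f \<in> borel_measurable borel" and S: "sym_pos_def S"
  shows "(\<integral>\<^sup>+x. f x \<partial>lborel) = ennreal (det S) * (\<integral>\<^sup>+x. f (S *v x) \<partial>lborel)"
proof -
  obtain P c where P: "orthogonal_matrix P" and c: "\<And>i. c i > 0" and SP: "S = P ** diag_mat c ** transpose P"
    using sym_pos_def_diagonalize[OF S] by (elim exE conjE) (rule that, auto)
  have "det P * det P = 1"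
    using det_orthogonal_matrix[OF P] by auto
  moreover have "det S = (det P * det P) * (\<Prod>i\<in>UNIV. c i)"
    unfolding SP det_mul det_transpose det_diag_mat by (simp only: mult_ac)
  ultimately have det: "det S = (\<Prod>i\<in>UNIV. c i)"
    by simp
  have "(\<integral>\<^sup>+x. f (S *v x) \<partial>lborel) = (\<integral>\<^sup>+x. f (P *v (diag_mat c *v (transpose P *v x))) \<partial>lborel)"
    by (simp only: SP matrix_vector_mul_assoc matrix_mul_assoc)
  also have "\<dots> = (\<integral>\<^sup>+x. f (P *v (diag_mat c *v x)) \<partial>lborel)"
    using P by (intro nn_integral_lborel_orthogonal) simp_all
  finally have "ennreal (det S) * (\<integral>\<^sup>+x. f (S *v x) \<partial>lborel) = (\<integral>\<^sup>+x. f (P *v x) \<partial>lborel)"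
    unfolding det by (subst nn_integral_lborel_diag[where f="\<lambda>x. f (P *v x)", OF _ c]) simp_all
  also have "\<dots> = (\<integral>\<^sup>+x. f x \<partial>lborel)"
    using P by (rule nn_integral_lborel_orthogonal[OF f])
  finally show ?thesis ..
qed

text \<open>Substitute \<open>x = m + S u\<close> with \<open>S\<close> the root of
  \<open>A\<close>: the weighted norm becomes the Euclidean one and the Jacobian is
  \<open>det S = sqrt (det A)\<close>. All dependence on the covariance is thus confined to one
  factor.\<close>

lemma nn_integral_wnorm:
  fixes f :: "real \<Rightarrow> ennreal" and A :: "real^'n^'n"
  assumes [measurable]: "f \<in> borel_measurable borel" and A: "sym_pos_def A"
  shows "(\<integral>\<^sup>+x. f (wnorm A (x - m)) \<partial>lborel) = ennreal (sqrt (det A)) * (\<integral>\<^sup>+u. f (norm (u::real^'n)) \<partial>lborel)"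
proof -
  define S where "S = mat_sqrt A"
  have S: "sym_pos_def S" and SA: "S ** S = A"
    unfolding S_def by (rule mat_sqrt_sym_pos_def[OF A])+
  have inv: "matrix_inv S *v (S *v x) = x" for x
    unfolding matrix_vector_mul_assoc sym_pos_def_inverse(2)[OF S] by simp
  have "det A = det S * det S"
    by (simp add: det_mul SA[symmetric])
  then have det: "sqrt (det A) = det S"
    using det_sym_pos_def[OF S] by simp
  have "(\<integral>\<^sup>+x. f (wnorm A (x - m)) \<partial>lborel) = (\<integral>\<^sup>+x. f (wnorm A x) \<partial>lborel)"
    using nn_integral_lborel_translate[of "\<lambda>x. f (wnorm A x)" "- m"] by (simp add: wnorm_def)
  also have "\<dots> = ennreal (det S) * (\<integral>\<^sup>+x. f (wnorm A (S *v x)) \<partial>lborel)"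
    by (rule nn_integral_lborel_sym_pos_def[OF _ S]) (simp add: wnorm_def)
  finally show ?thesis
    by (simp add: wnorm_def S_def[symmetric] inv det)
qed

lemma
  fixes f :: "real \<Rightarrow> real" and A :: "real^'n^'n"
  assumes f [measurable]: "f \<in> borel_measurable borel" and nonneg: "\<And>s. f s \<ge> 0" and A: "sym_pos_def A"
    and int: "integrable lborel (\<lambda>u::real^'n. f (norm u))"
  shows integrable_wnorm: "integrable lborel (\<lambda>x. f (wnorm A (x - m)))"
    and integral_wnorm: "(LINT x|lborel. f (wnorm A (x - m))) = sqrt (det A) * (LINT u|lborel. f (norm (u::real^'n)))"
proof -
  have "(\<integral>\<^sup>+x. ennreal (f (wnorm A (x - m))) \<partial>lborel) = ennreal (sqrt (det A)) * (\<integral>\<^sup>+u. ennreal (f (norm (u::real^'n))) \<partial>lborel)"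
    by (rule nn_integral_wnorm[OF _ A]) simp
  also have "\<dots> = ennreal (sqrt (det A) * (LINT u|lborel. f (norm (u::real^'n))))"
    using det_sym_pos_def[OF A]
    by (simp add: nn_integral_eq_integral int nonneg ennreal_mult)
  finally have eq: "(\<integral>\<^sup>+x. ennreal (f (wnorm A (x - m))) \<partial>lborel) =
      ennreal (sqrt (det A) * (LINT u|lborel. f (norm (u::real^'n))))" .
  have [measurable]: "(\<lambda>x. f (wnorm A (x - m))) \<in> borel_measurable lborel"
    by (simp add: wnorm_def)
  show "integrable lborel (\<lambda>x. f (wnorm A (x - m)))"
    by (rule integrableI_nonneg) (simp_all add: nonneg eq)
  show "(LINT x|lborel. f (wnorm A (x - m))) = sqrt (det A) * (LINT u|lborel. f (norm (u::real^'n)))"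
    using det_sym_pos_def[OF A] by (subst integral_eq_nn_integral) (simp_all add: nonneg eq)
qed

section \<open>Gaussian integrals and moments\<close>

lemma nn_integral_gaussian_real:
  assumes "c > 0"
  shows "(\<integral>\<^sup>+x. ennreal (exp (- c * x\<^sup>2)) \<partial>lborel) = ennreal (sqrt (pi / c))"
proof -
  \<comment> \<open>The standard deviation for which \<open>c\<close> equals 1 / (2
    \<sigma>^2).\<close>
  define \<sigma> where "\<sigma> = 1 / sqrt (2 * c)"
  have \<sigma>: "\<sigma> > 0" "2 * \<sigma>\<^sup>2 = 1 / c"
    using assms by (simp_all add: \<sigma>_def power_divide)
  have eq: "exp (- c * x\<^sup>2) = sqrt (pi / c) * normal_density 0 \<sigma> x" for x
  proof -
    have "2 * pi * \<sigma>\<^sup>2 = pi / c"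
      using \<sigma>(2) by (metis mult.assoc mult.commute times_divide_eq_right mult.right_neutral)
    then have "normal_density 0 \<sigma> x = 1 / sqrt (pi / c) * exp (- c * x\<^sup>2)"
      using \<sigma>(2) by (simp add: normal_density_def mult.commute)
    then show ?thesis
      using assms by simp
  qed
  have "(\<integral>\<^sup>+x. ennreal (exp (- c * x\<^sup>2)) \<partial>lborel) = ennreal (\<integral>x. exp (- c * x\<^sup>2) \<partial>lborel)"
    using \<sigma> unfolding eq by (intro nn_integral_eq_integral) (use assms in \<open>auto intro!: AE_I2\<close>)
  also have "\<dots> = ennreal (sqrt (pi / c))"
    using \<sigma> unfolding eq by simp
  finally show ?thesis .
qed

lemma nn_integral_gaussian:
  assumes "c > 0"
  shows "(\<integral>\<^sup>+x. ennreal (exp (- c * (norm x)\<^sup>2)) \<partial>(lborel :: 'a::euclidean_space measure)) = ennreal (sqrt (pi / c) ^ DIM('a))"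
proof -
  have "exp (- c * (norm x)\<^sup>2) = (\<Prod>b\<in>Basis. exp (- c * (x \<bullet> b)\<^sup>2))" for x :: 'a
    unfolding power2_norm_eq_inner euclidean_inner[of x x]
    by (simp add: exp_sum sum_distrib_left power2_eq_square flip: sum_negf)
  then have "(\<integral>\<^sup>+x. ennreal (exp (- c * (norm x)\<^sup>2)) \<partial>(lborel :: 'a measure)) =
      (\<integral>\<^sup>+x. (\<Prod>b\<in>Basis. ennreal (exp (- c * (x \<bullet> b)\<^sup>2))) \<partial>(lborel :: 'a measure))"
    by (simp add: prod_ennreal)
  also have "\<dots> = (\<Prod>b\<in>(Basis::'a set). ennreal (sqrt (pi / c)))"
    by (subst nn_integral_lborel_prod) (simp_all add: nn_integral_gaussian_real[OF assms, simplified])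
  also have "\<dots> = ennreal (sqrt (pi / c) ^ DIM('a))"
    using assms by (simp add: ennreal_power)
  finally show ?thesis .
qed

lemma
  assumes "c > 0"
  shows integrable_gaussian: "integrable lborel (\<lambda>x::'a::euclidean_space. exp (- c * (norm x)\<^sup>2))"
    and integral_gaussian: "(LINT x|lborel. exp (- c * (norm (x::'a))\<^sup>2)) = sqrt (pi / c) ^ DIM('a)"
proof -
  show "integrable lborel (\<lambda>x::'a. exp (- c * (norm x)\<^sup>2))"
    by (rule integrableI_nonneg) (simp_all add: nn_integral_gaussian[OF assms, simplified])
  show "(LINT x|lborel. exp (- c * (norm (x::'a))\<^sup>2)) = sqrt (pi / c) ^ DIM('a)"
    using assms by (subst integral_eq_nn_integral) (simp_all add: nn_integral_gaussian[OF assms, simplified])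
qed

lemma power_le_exp:
  fixes z :: real
  assumes "z \<ge> 0"
  shows "z ^ k \<le> fact k * exp z"
proof -
  have "z ^ k / fact k \<le> (\<Sum>i<Suc k. z ^ i / fact i)"
    using assms by (intro member_le_sum[of k]) auto
  also obtain t where "exp z = (\<Sum>i<Suc k. z ^ i / fact i) + exp t / fact (Suc k) * z ^ Suc k"
    using Maclaurin_exp_le by blast
  then have "(\<Sum>i<Suc k. z ^ i / fact i) \<le> exp z"
    using assms by (simp del: sum.lessThan_Suc fact_Suc)
  finally show ?thesis
    by (simp add: field_simps)
qed

lemma integrable_norm_power_gaussian:
  assumes c: "c > 0"
  shows "integrable lborel (\<lambda>x::'a::euclidean_space. norm x ^ k * exp (- c * (norm x)\<^sup>2))"
proof (rule Bochner_Integration.integrable_bound)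
  \<comment> \<open>Half of the exponent, \<open>z = c / 2 * s^2\<close>, absorbs the power of
    \<open>s\<close>. Passing from \<open>s ^ k\<close> to \<open>1 + s ^ (2 * k)\<close> makes it a
    power of \<open>z\<close>, and z^k \<le> k! exp z then gives \<open>M\<close>.\<close>
  define M where "M = 1 + (2 / c) ^ k * fact k"
  show "integrable lborel (\<lambda>x::'a. M * exp (- (c / 2) * (norm x)\<^sup>2))"
    using c by (intro integrable_mult_right integrable_gaussian) simp
  show "AE x in lborel. norm (norm x ^ k * exp (- c * (norm x)\<^sup>2)) \<le> norm (M * exp (- (c / 2) * (norm (x::'a))\<^sup>2))"
  proof (rule AE_I2)
    fix x :: 'a
    define s where "s = norm x"
    have s: "s \<ge> 0"
      by (simp add: s_def)
    define z where "z = c / 2 * s\<^sup>2"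
    have z: "z \<ge> 0"
      using c by (simp add: z_def)
    have "s ^ k \<le> 1 + s ^ (2 * k)"
    proof (cases "s \<le> 1")
      case True
      with s have "s ^ k \<le> 1"
        by (simp add: power_le_one)
      then show ?thesis
        using s by (simp add: add_increasing2)
    next
      case False
      then have "s ^ k \<le> s ^ (2 * k)"
        by (intro power_increasing) auto
      then show ?thesis by simp
    qed
    also have "s ^ (2 * k) = (2 / c) ^ k * z ^ k"
      using c by (simp add: z_def power_mult power_mult_distrib[symmetric])
    also have "\<dots> \<le> (2 / c) ^ k * (fact k * exp z)"
      using c z by (intro mult_left_mono power_le_exp) auto
    also have "1 + \<dots> \<le> M * exp z"
      using z by (simp add: M_def algebra_simps)
    finally have "s ^ k * exp (- c * s\<^sup>2) \<le> M * exp z * exp (- c * s\<^sup>2)"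
      by (intro mult_right_mono) auto
    also have "\<dots> = M * exp (- (c / 2) * s\<^sup>2)"
      by (simp add: z_def mult.assoc exp_add[symmetric])
    finally show "norm (norm x ^ k * exp (- c * (norm x)\<^sup>2)) \<le> norm (M * exp (- (c / 2) * (norm x)\<^sup>2))"
      unfolding s_def[symmetric] using s c by (simp add: M_def abs_mult)
  qed
qed simp

section \<open>Third-order Taylor expansion\<close>

lemma has_derivative_lincomb:
  fixes f g :: "'a::real_normed_vector \<Rightarrow> real"
  assumes "f differentiable at x" "g differentiable at x"
  shows "((\<lambda>x. a * f x + b * g x) has_derivative
      (\<lambda>h. a * frechet_derivative f (at x) h + b * frechet_derivative g (at x) h)) (at x)"
  using assms unfolding frechet_derivative_works
  by (intro has_derivative_add has_derivative_mult_right)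

lemma frechet_derivative_lincomb:
  fixes f g :: "'a::real_normed_vector \<Rightarrow> real"
  assumes "f differentiable at x" "g differentiable at x"
  shows "frechet_derivative (\<lambda>x. a * f x + b * g x) (at x) h =
    a * frechet_derivative f (at x) h + b * frechet_derivative g (at x) h"
  using fun_cong[OF frechet_derivative_at[OF has_derivative_lincomb[OF assms, of a b]], of h] by simp

lemma C_class_lincomb:
  "C_class k f \<Longrightarrow> C_class k g \<Longrightarrow> C_class k (\<lambda>x. a * f x + b * g x)"
proof (induction k arbitrary: f g)
  case 0
  then show ?case
    by (auto intro!: continuous_intros)
next
  case (Suc k)
  then have "f differentiable at x" "g differentiable at x" for x
    by simp_all
  moreover from this have "(\<lambda>x. a * f x + b * g x) differentiable at x" for x
    using has_derivative_lincomb differentiable_def by blast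
  ultimately show ?case
    using Suc by (simp add: frechet_derivative_lincomb)
qed

lemma C_class_Suc_imp:
  "C_class (Suc k) f \<Longrightarrow> C_class k f"
proof (induction k arbitrary: f)
  case 0
  then show ?case
    by (auto intro!: differentiable_imp_continuous_on simp: differentiable_on_def differentiable_at_withinI)
next
  case (Suc k)
  then show ?case
    by (metis C_class.simps(2))
qed

lemma C_class_mono:
  assumes "C_class k f" "j \<le> k"
  shows "C_class j f"
  using assms(2,1) by (rule inc_induct) (rule C_class_Suc_imp)

lemma iter_deriv_lincomb:
  "C_class (length hs) f \<Longrightarrow> C_class (length hs) g \<Longrightarrow>
    iter_deriv hs (\<lambda>x. a * f x + b * g x) x = a * iter_deriv hs f x + b * iter_deriv hs g x"
proof (induction hs arbitrary: f g)
  case (Cons h hs)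
  then have "(\<lambda>x. frechet_derivative (\<lambda>x. a * f x + b * g x) (at x) h) =
      (\<lambda>x. a * frechet_derivative f (at x) h + b * frechet_derivative g (at x) h)"
    by (intro ext frechet_derivative_lincomb) auto
  with Cons show ?case
    by simp
qed simp

text \<open>Linearity in one slot: the directions \<open>xs\<close> before it are absorbed into
  \<open>f\<close>, then the Frechet derivative is linear in \<open>h\<close>, and the remaining
  directions \<open>ys\<close> respect linear combinations of functions.\<close>

lemma linear_iter_deriv:
  assumes "C_class (length xs + Suc (length ys)) f"
  shows "linear (\<lambda>h. iter_deriv (xs @ h # ys) f x)"
  using assms
proof (induction xs arbitrary: f)
  case Nil
  then have f: "C_class (Suc (length ys)) f" by simp
  have lin: "linear (frechet_derivative f (at x))" for x
    using f by (intro linear_frechet_derivative) auto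
  have eq: "iter_deriv ys (\<lambda>x. frechet_derivative f (at x) (a *\<^sub>R h + b *\<^sub>R k)) x =
      a * iter_deriv ys (\<lambda>x. frechet_derivative f (at x) h) x + b * iter_deriv ys (\<lambda>x. frechet_derivative f (at x) k) x"
    for a b h k
    using f by (simp add: linear_add[OF lin] linear_scale[OF lin] iter_deriv_lincomb)
  show ?case
    using eq[of 1 _ 1] eq[of _ _ 0] by (intro linearI) simp_all
qed simp

text \<open>The recursion applies the first direction first, so the last one is the outermost
  derivative. In this form one further differentiation can be attached.\<close>

lemma iter_deriv_snoc:
  "iter_deriv (hs @ [h]) f x = frechet_derivative (iter_deriv hs f) (at x) h"
  by (induction hs arbitrary: f) simp_all

lemma differentiable_iter_deriv:
  "C_class (Suc (length hs)) f \<Longrightarrow> iter_deriv hs f differentiable at x"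
proof (induction hs arbitrary: f)
  case (Cons h hs)
  then have "C_class (Suc (length hs)) (\<lambda>x. frechet_derivative f (at x) h)"
    by simp
  from Cons.IH[OF this] show ?case
    by simp
qed simp

lemma has_real_derivative_iter_deriv_line:
  assumes "C_class (Suc m) f"
  shows "((\<lambda>s. iter_deriv (replicate m h) f (z + s *\<^sub>R h)) has_real_derivative
      iter_deriv (replicate (Suc m) h) f (z + s *\<^sub>R h)) (at s)"
proof -
  let ?g = "iter_deriv (replicate m h) f"
  have rep: "replicate (Suc m) h = replicate m h @ [h]"
    by (simp add: replicate_append_same)
  have d: "(?g has_derivative frechet_derivative ?g (at (z + s *\<^sub>R h))) (at (z + s *\<^sub>R h))"
    using differentiable_iter_deriv[of "replicate m h" f] assms by (simp add: frechet_derivative_works)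
  have "((\<lambda>s. ?g (z + s *\<^sub>R h)) has_derivative
     (\<lambda>r. frechet_derivative ?g (at (z + s *\<^sub>R h)) (r *\<^sub>R h))) (at s)"
    by (rule has_derivative_compose[where f="\<lambda>s. z + s *\<^sub>R h" and g="?g", OF _ d]) (auto intro!: derivative_eq_intros)
  moreover have "frechet_derivative ?g (at (z + s *\<^sub>R h)) (r *\<^sub>R h) =
      r * iter_deriv (replicate (Suc m) h) f (z + s *\<^sub>R h)" for r
    unfolding rep iter_deriv_snoc using linear_scale[OF has_derivative_linear[OF d]] by simp
  ultimately show ?thesis
    by (simp add: has_field_derivative_def mult.commute[of _ "iter_deriv (replicate (Suc m) h) f (z + s *\<^sub>R h)"] del: replicate.simps)
qed

text \<open>The one-dimensional formula with Lagrange remainder, applied to \<open>f\<close> along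
  the segment from \<open>z\<close> to \<open>z + h\<close>. The position of \<open>s\<close> is not
  recorded, as third derivatives will be bounded at every point.\<close>

lemma taylor_third_order:
  assumes f: "C_class 3 f"
  obtains s where "f (z + h) = f z + iter_deriv [h] f z + iter_deriv [h, h] f z / 2
      + iter_deriv [h, h, h] f (z + s *\<^sub>R h) / 6"
proof -
  define diff where "diff m s = iter_deriv (replicate m h) f (z + s *\<^sub>R h)" for m s
  have "\<exists>t>0. t < 1 \<and> diff 0 1 = (\<Sum>m<3. diff m 0 / fact m * 1 ^ m) + diff 3 t / fact 3 * 1 ^ 3"
  proof (rule Maclaurin)
    show "\<forall>m t. m < 3 \<and> 0 \<le> t \<and> t \<le> 1 \<longrightarrow> (diff m has_real_derivative diff (Suc m) t) (at t)"
      unfolding diff_def by (intro allI impI has_real_derivative_iter_deriv_line C_class_mono[OF f]) auto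
  qed simp_all
  then obtain t where "diff 0 1 = (\<Sum>m<3. diff m 0 / fact m * 1 ^ m) + diff 3 t / fact 3 * 1 ^ 3"
    by blast
  then show thesis
    by (intro that[of t]) (simp add: eval_nat_numeral diff_def)
qed

lemma iter_deriv_eq_0_at_minimum:
  assumes f: "C_class 1 f" and min: "\<And>x. f z \<le> f x"
  shows "iter_deriv [h] f z = 0"
proof -
  have "((\<lambda>s. f (z + s *\<^sub>R h)) has_real_derivative iter_deriv [h] f z) (at 0)"
    using has_real_derivative_iter_deriv_line[of 0 f h z 0] f by simp
  then show ?thesis
    by (rule DERIV_local_min[of _ _ _ 1]) (auto simp: min)
qed

lemma iter_deriv_2_hessian:
  assumes f: "C_class 2 f"
  shows "iter_deriv [h, k] f x = h \<bullet> (hessian f x *v k)"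
proof -
  have l1: "linear (\<lambda>h. iter_deriv [h, k] f x)" for k
    using linear_iter_deriv[of "[]" "[k]" f x] f by (simp del: C_class.simps add: eval_nat_numeral)
  have l2: "linear (\<lambda>k. iter_deriv [h, k] f x)" for h
    using linear_iter_deriv[of "[h]" "[]" f x] f by (simp del: C_class.simps add: eval_nat_numeral)
  have "iter_deriv [h, k] f x = (\<Sum>i\<in>UNIV. h $ i * iter_deriv [axis i 1, k] f x)"
    by (subst basis_expansion[of h, symmetric])
      (simp add: linear_sum[OF l1] linear_scale[OF l1] scalar_mult_eq_scaleR del: iter_deriv.simps)
  also have "\<dots> = (\<Sum>i\<in>UNIV. h $ i * (\<Sum>j\<in>UNIV. k $ j * iter_deriv [axis i 1, axis j 1] f x))"
    by (subst basis_expansion[of k, symmetric])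
      (simp add: linear_sum[OF l2] linear_scale[OF l2] scalar_mult_eq_scaleR del: iter_deriv.simps)
  also have "\<dots> = h \<bullet> (hessian f x *v k)"
    by (simp add: inner_vec_def matrix_vector_mult_def hessian_def mult.commute del: iter_deriv.simps)
  finally show ?thesis .
qed

section \<open>Third derivatives in the weighted norm\<close>

lemma linear_functional_bound:
  fixes L :: "'a::euclidean_space \<Rightarrow> real"
  assumes L: "linear L" and h: "norm h \<le> r"
  shows "\<bar>L h\<bar> \<le> r * (\<Sum>b\<in>Basis. \<bar>L b\<bar>)"
proof -
  have "L h = (\<Sum>b\<in>Basis. (h \<bullet> b) * L b)"
    by (subst euclidean_representation[of h, symmetric]) (simp only: linear_sum[OF L] linear_scale[OF L] real_scaleR_def)
  also have "\<bar>\<dots>\<bar> \<le> (\<Sum>b\<in>Basis. \<bar>(h \<bullet> b) * L b\<bar>)"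
    by (rule sum_abs)
  also have "\<dots> \<le> (\<Sum>b\<in>Basis. r * \<bar>L b\<bar>)"
    using h by (intro sum_mono) (auto simp: abs_mult intro!: mult_right_mono order_trans[OF Basis_le_norm])
  finally show ?thesis
    by (simp add: sum_distrib_left)
qed

text \<open>Expands one argument after another in the basis. It serves to bound the set in
  \<open>D3_wnorm\<close>: a real \<open>Sup\<close> dominates its elements only if that set is
  bounded above.\<close>

lemma trilinear_bound:
  fixes T :: "'a::euclidean_space \<Rightarrow> 'a \<Rightarrow> 'a \<Rightarrow> real"
  assumes T: "\<And>b c. linear (\<lambda>a. T a b c)" "\<And>a c. linear (\<lambda>b. T a b c)" "\<And>a b. linear (\<lambda>c. T a b c)"
  obtains M where "\<And>a b c. norm a \<le> r \<Longrightarrow> norm b \<le> r \<Longrightarrow> norm c \<le> r \<Longrightarrow> \<bar>T a b c\<bar> \<le> M"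
proof
  fix a b c :: 'a
  assume *: "norm a \<le> r" "norm b \<le> r" "norm c \<le> r"
  then have r: "r \<ge> 0"
    using norm_ge_zero order_trans by blast
  have "\<bar>T a b c\<bar> \<le> r * (\<Sum>i\<in>Basis. \<bar>T i b c\<bar>)"
    using * by (intro linear_functional_bound T)
  also have "\<dots> \<le> r * (\<Sum>i\<in>Basis. r * (\<Sum>j\<in>Basis. \<bar>T i j c\<bar>))"
    using * r by (intro mult_left_mono sum_mono linear_functional_bound T)
  also have "\<dots> \<le> r * (\<Sum>i\<in>Basis. r * (\<Sum>j\<in>Basis. r * (\<Sum>k\<in>Basis. \<bar>T i j k\<bar>)))"
    using * r by (intro mult_left_mono sum_mono linear_functional_bound T)
  finally show "\<bar>T a b c\<bar> \<le> r * (\<Sum>i\<in>Basis. r * (\<Sum>j\<in>Basis. r * (\<Sum>k\<in>Basis. \<bar>T i j k\<bar>)))" .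
qed

lemma linear_iter_deriv_3:
  assumes "C_class 3 g"
  shows "linear (\<lambda>a. iter_deriv [a, b, c] g x)" "linear (\<lambda>b. iter_deriv [a, b, c] g x)"
    "linear (\<lambda>c. iter_deriv [a, b, c] g x)"
  using linear_iter_deriv[of "[]" "[b, c]" g x] linear_iter_deriv[of "[a]" "[c]" g x]
    linear_iter_deriv[of "[a, b]" "[]" g x] assms
  by (simp_all del: C_class.simps iter_deriv.simps add: numeral_3_eq_3)

lemma wnorm_scaleR: "wnorm \<Sigma> (c *\<^sub>R x) = \<bar>c\<bar> * wnorm \<Sigma> x"
  by (simp add: wnorm_def matrix_vector_mult_scaleR)

text \<open>Cubic homogeneity reduces the claim to the unit ball of \<open>wnorm \<Sigma>\<close>.
  This ball lies in a Euclidean ball whose radius \<open>r\<close> bounds the operator norm of the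
  root of \<open>\<Sigma>\<close>, so the supremum is a genuine upper bound.\<close>

lemma iter_deriv_3_le_D3_wnorm:
  assumes g: "C_class 3 g" and S: "sym_pos_def \<Sigma>"
  shows "\<bar>iter_deriv [h, h, h] g x\<bar> \<le> D3_wnorm \<Sigma> g x * wnorm \<Sigma> h ^ 3"
proof -
  let ?T = "\<lambda>a b c. iter_deriv [a, b, c] g x"
  note lin = linear_iter_deriv_3[OF g, of _ _ x]
  define S where "S = mat_sqrt \<Sigma>"
  have "S ** matrix_inv S = mat 1"
    unfolding S_def by (rule sym_pos_def_inverse(1)[OF mat_sqrt_sym_pos_def(1)[OF S]])
  then have S_inv: "S *v (matrix_inv S *v a) = a" for a
    by (simp add: matrix_vector_mul_assoc)
  obtain r where r: "\<And>a. norm (S *v a) \<le> norm a * r" "r > 0"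
    using bounded_linear.pos_bounded[OF matrix_vector_mul_bounded_linear[of S]] by blast
  have norm_le: "norm a \<le> r" if "wnorm \<Sigma> a \<le> 1" for a
  proof -
    have "norm a \<le> wnorm \<Sigma> a * r"
      using r(1)[of "matrix_inv S *v a"] by (simp add: wnorm_def S_def[symmetric] S_inv)
    also have "\<dots> \<le> r"
      using that r(2) by simp
    finally show ?thesis .
  qed
  obtain M where M: "\<And>a b c. norm a \<le> r \<Longrightarrow> norm b \<le> r \<Longrightarrow> norm c \<le> r \<Longrightarrow> \<bar>?T a b c\<bar> \<le> M"
    using trilinear_bound[of ?T r] lin by blast
  let ?X = "{\<bar>?T a b c\<bar> | a b c. wnorm \<Sigma> a \<le> 1 \<and> wnorm \<Sigma> b \<le> 1 \<and> wnorm \<Sigma> c \<le> 1}"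
  have "bdd_above ?X"
    using M norm_le by (intro bdd_aboveI[of _ M]) blast
  then have le: "\<bar>?T a a a\<bar> \<le> D3_wnorm \<Sigma> g x" if "wnorm \<Sigma> a \<le> 1" for a
    unfolding D3_wnorm_def using that by (intro cSup_upper) blast+
  show ?thesis
  proof (cases "wnorm \<Sigma> h = 0")
    case True
    then have "h = 0"
      using S_inv[of h] by (simp add: wnorm_def S_def[symmetric])
    then have "?T h h h = 0"
      using linear_0[OF lin(1)] by blast
    then show ?thesis
      using True by simp
  next
    case False
    define w where "w = wnorm \<Sigma> h"
    have w: "w > 0"
      using False by (simp add: w_def wnorm_def)
    define a where "a = h /\<^sub>R w"
    have h: "h = w *\<^sub>R a"
      using w by (simp add: a_def)
    have "wnorm \<Sigma> a \<le> 1"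
      using w by (simp add: a_def wnorm_scaleR w_def[symmetric])
    moreover have "?T h h h = w ^ 3 * ?T a a a"
      unfolding h linear_scale[OF lin(1)] linear_scale[OF lin(2)] linear_scale[OF lin(3)]
      by (simp add: power3_eq_cube)
    ultimately show ?thesis
      using le[of a] w by (simp add: abs_mult w_def[symmetric] mult.commute del: iter_deriv.simps)
  qed
qed

text \<open>At the minimizer the value and the first derivative of \<open>f\<close> vanish and the
  Hessian term is the squared weighted norm, so only the Lagrange remainder is left.\<close>

lemma taylor_shifted_objective:
  fixes \<Phi> R :: "real^'n \<Rightarrow> real" and z :: "real^'n" and \<epsilon> :: real
  defines "f \<equiv> shifted_objective \<epsilon> \<Phi> R z"
  assumes C3: "C_class 3 \<Phi>" "C_class 3 R" and \<epsilon>: "0 < \<epsilon>" "\<epsilon> \<le> 1"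
    and \<Sigma>: "\<Sigma> = matrix_inv (hessian f z)" and spd: "sym_pos_def (hessian f z)"
    and min: "\<And>x. f z \<le> f x"
    and K: "\<And>x. D3_wnorm \<Sigma> \<Phi> x \<le> K" "\<And>x. D3_wnorm \<Sigma> R x \<le> K" and "K > 0"
  shows "C_class 3 f" "sym_pos_def \<Sigma>" "\<bar>f x - (wnorm \<Sigma> (x - z))\<^sup>2 / 2\<bar> \<le> K / 3 * wnorm \<Sigma> (x - z) ^ 3"
proof -
  have const: "C_class 3 (\<lambda>_::real^'n. c)" for c :: real
    by (simp add: eval_nat_numeral)
  define g where "g x = 1 * \<Phi> x + \<epsilon> * R x" for x
  have g: "C_class 3 g"
    unfolding g_def by (intro C_class_lincomb C3)
  \<comment> \<open>The shift by a constant is written as a linear combination so that the rules for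
    smoothness and iterated derivatives apply to it.\<close>
  have f_eq: "f = (\<lambda>x. 1 * g x + 1 * (- g z))"
    by (auto simp: f_def shifted_objective_def g_def)
  show f: "C_class 3 f"
    unfolding f_eq by (intro C_class_lincomb const g)
  show spd': "sym_pos_def \<Sigma>"
    unfolding \<Sigma> by (rule sym_pos_def_inverse(3)[OF spd])
  define h where "h = x - z"
  have inv: "matrix_inv \<Sigma> = hessian f z"
    unfolding \<Sigma> by (rule matrix_inv_eqI) (rule sym_pos_def_inverse(2)[OF spd])
  obtain s where "f (z + h) = f z + iter_deriv [h] f z + iter_deriv [h, h] f z / 2
      + iter_deriv [h, h, h] f (z + s *\<^sub>R h) / 6"
    using taylor_third_order[OF f] by blast
  moreover have "f z = 0"
    by (simp add: f_def shifted_objective_def)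
  moreover have "iter_deriv [h] f z = 0"
    by (intro iter_deriv_eq_0_at_minimum C_class_mono[OF f] min) simp
  moreover have "iter_deriv [h, h] f z = (wnorm \<Sigma> h)\<^sup>2"
    using iter_deriv_2_hessian[of f h h z] C_class_mono[OF f, of 2] wnorm_squared[OF spd'] inv
    by (simp del: iter_deriv.simps C_class.simps)
  ultimately have f_taylor: "f x - (wnorm \<Sigma> h)\<^sup>2 / 2 = iter_deriv [h, h, h] f (z + s *\<^sub>R h) / 6"
    by (simp add: h_def)
  have f3: "iter_deriv [h, h, h] f y = iter_deriv [h, h, h] \<Phi> y + \<epsilon> * iter_deriv [h, h, h] R y" for y
  proof -
    have "iter_deriv [h, h, h] f y = iter_deriv [h, h, h] g y + iter_deriv [h, h, h] (\<lambda>_. - g z) y"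
      unfolding f_eq using iter_deriv_lincomb[of "[h, h, h]" g "\<lambda>_. - g z" 1 1 y] g const
      by (simp del: C_class.simps iter_deriv.simps add: numeral_3_eq_3)
    also have "iter_deriv [h, h, h] (\<lambda>_. - g z) y = 0"
      by simp
    also have "iter_deriv [h, h, h] g y = iter_deriv [h, h, h] \<Phi> y + \<epsilon> * iter_deriv [h, h, h] R y"
      unfolding g_def using iter_deriv_lincomb[of "[h, h, h]" \<Phi> R 1 \<epsilon> y] C3
      by (simp del: C_class.simps iter_deriv.simps add: numeral_3_eq_3)
    finally show ?thesis by simp
  qed
  have \<Phi>3: "\<bar>iter_deriv [h, h, h] \<Phi> y\<bar> \<le> K * wnorm \<Sigma> h ^ 3" for y
    using iter_deriv_3_le_D3_wnorm[OF C3(1) spd', of h y] K(1)[of y]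
    by (elim order_trans) (simp add: mult_right_mono wnorm_def)
  have R3: "\<bar>\<epsilon> * iter_deriv [h, h, h] R y\<bar> \<le> 1 * (K * wnorm \<Sigma> h ^ 3)" for y
    unfolding abs_mult
  proof (intro mult_mono)
    show "\<bar>iter_deriv [h, h, h] R y\<bar> \<le> K * wnorm \<Sigma> h ^ 3"
      using iter_deriv_3_le_D3_wnorm[OF C3(2) spd', of h y] K(2)[of y]
      by (elim order_trans) (simp add: mult_right_mono wnorm_def)
  qed (use \<epsilon> in auto)
  \<comment> \<open>One \<open>K\<close> from \<open>\<Phi>\<close> and at most one from
    \<open>R\<close>, by \<epsilon> \<le> 1. Division by 6 leaves \<open>K / 3\<close>.\<close>
  have "\<bar>iter_deriv [h, h, h] f y\<bar> \<le> 2 * (K * wnorm \<Sigma> h ^ 3)" for y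
    unfolding f3 using \<Phi>3[of y] R3[of y] by linarith
  from this[of "z + s *\<^sub>R h"]
  show "\<bar>f x - (wnorm \<Sigma> (x - z))\<^sup>2 / 2\<bar> \<le> K / 3 * wnorm \<Sigma> (x - z) ^ 3"
    unfolding h_def[symmetric] f_taylor by (simp del: iter_deriv.simps)
qed

section \<open>Total variation distance to the Laplace approximation\<close>

lemma measure_normalized_density:
  fixes a :: "'a \<Rightarrow> real"
  assumes a: "integrable M a" "\<And>x. a x \<ge> 0" and Z: "Z > 0" and A: "A \<in> sets M"
  shows "measure (density M (\<lambda>x. ennreal (a x / Z))) A = (LINT x:A|M. a x) / Z"
proof -
  have "emeasure (density M (\<lambda>x. ennreal (a x / Z))) A = (\<integral>\<^sup>+x. ennreal (a x / Z) * indicator A x \<partial>M)"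
    using a A by (intro emeasure_density) auto
  also have "\<dots> = (\<integral>\<^sup>+x. ennreal (indicator A x * a x / Z) \<partial>M)"
    by (intro nn_integral_cong) (auto simp: indicator_def)
  also have "\<dots> = ennreal (\<integral>x. indicator A x * a x / Z \<partial>M)"
    using a Z integrable_mult_indicator[OF A a(1)] by (intro nn_integral_eq_integral) auto
  finally show ?thesis
    using a Z by (simp add: measure_def set_lebesgue_integral_def enn2real_ennreal integral_nonneg_AE)
qed

text \<open>
  With \<open>a\<^sub>A = \<integral>\<^sub>A a\<close> and \<open>a\<^sub>A + a\<^sub>A' = Z\<close>, and likewise for \<open>b\<close>, the numerator of \<open>a\<^sub>A / Z - b\<^sub>A / W\<close> is
  \<open>a\<^sub>A (b\<^sub>A' - a\<^sub>A') + a\<^sub>A' (a\<^sub>A - b\<^sub>A)\<close>. This avoids a factor \<open>2\<close> and any bound on \<open>Z\<close>.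
\<close>

lemma tv_dist_normalized_densities:
  fixes a b :: "'a::euclidean_space \<Rightarrow> real"
  assumes a: "integrable lborel a" "\<And>x. a x > 0" and b: "integrable lborel b" "\<And>x. b x > 0"
  defines "Z \<equiv> (LINT x|lborel. a x)" and "W \<equiv> (LINT x|lborel. b x)"
  shows "tv_dist (density lborel (\<lambda>x. ennreal (a x / Z))) (density lborel (\<lambda>x. ennreal (b x / W)))
    \<le> (LINT x|lborel. \<bar>a x - b x\<bar>) / W"
proof -
  \<comment> \<open>A positive function with integral zero would vanish almost everywhere, which is
    impossible because Lebesgue measure is not the zero measure.\<close>
  have pos: "(LINT x|lborel. f x) > 0" if "integrable lborel f" "\<And>x. f x > 0" for f :: "'a \<Rightarrow> real"
  proof -
    have "(LINT x|lborel. f x) \<noteq> 0"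
    proof
      assume "(LINT x|lborel. f x) = 0"
      then have "AE x in lborel. f x = 0"
        using that by (subst (asm) integral_nonneg_eq_0_iff_AE) (auto simp: less_imp_le)
      then have "AE x in (lborel :: 'a measure). False"
        using that(2) by (auto simp: less_imp_neq[symmetric])
      then show False
        by (simp add: eventually_False ae_filter_eq_bot_iff)
    qed
    moreover have "(LINT x|lborel. f x) \<ge> 0"
      using that(2) by (intro integral_nonneg_AE) (auto simp: less_imp_le)
    ultimately show ?thesis by simp
  qed
  have Z: "Z > 0" and W: "W > 0"
    unfolding Z_def W_def using a b by (auto intro: pos)
  have si: "set_integrable lborel A f" if "integrable lborel f" "A \<in> sets borel" for A and f :: "'a \<Rightarrow> real"
    unfolding set_integrable_def using that by (intro integrable_mult_indicator) auto
  have split: "(LINT x:A|lborel. f x) + (LINT x:-A|lborel. f x) = (LINT x|lborel. f x)"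
    if "integrable lborel f" "A \<in> sets borel" for A and f :: "'a \<Rightarrow> real"
  proof -
    have "(LINT x:A|lborel. f x) + (LINT x:-A|lborel. f x) = (LINT x:A \<union> -A|lborel. f x)"
      using that by (subst set_integral_Un) (auto intro!: si)
    then show ?thesis
      by (simp add: set_lebesgue_integral_def)
  qed
  define D where "D = (LINT x|lborel. \<bar>a x - b x\<bar>)"
  have diff: "\<bar>(LINT x:A|lborel. a x) - (LINT x:A|lborel. b x)\<bar> \<le> (LINT x:A|lborel. \<bar>a x - b x\<bar>)"
    if A: "A \<in> sets borel" for A
  proof -
    have "(LINT x:A|lborel. a x) - (LINT x:A|lborel. b x) = (LINT x:A|lborel. a x - b x)"
      using a b A by (intro set_integral_diff(2)[symmetric] si) auto
    also have "\<bar>\<dots>\<bar> \<le> (LINT x:A|lborel. \<bar>a x - b x\<bar>)"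
      using set_integral_norm_bound[of lborel A "\<lambda>x. a x - b x"] a b A by (simp add: si)
    finally show ?thesis .
  qed
  have nonneg: "(LINT x:A|lborel. a x) \<ge> 0" for A
    unfolding set_lebesgue_integral_def using a by (intro integral_nonneg_AE) (auto simp: less_imp_le)
  have "\<bar>measure (density lborel (\<lambda>x. ennreal (a x / Z))) A - measure (density lborel (\<lambda>x. ennreal (b x / W))) A\<bar> \<le> D / W"
    if A: "A \<in> sets borel" for A
  proof -
    define a1 a2 b1 b2 where "a1 = (LINT x:A|lborel. a x)" and "a2 = (LINT x:-A|lborel. a x)"
      and "b1 = (LINT x:A|lborel. b x)" and "b2 = (LINT x:-A|lborel. b x)"
    define d1 d2 where "d1 = (LINT x:A|lborel. \<bar>a x - b x\<bar>)" and "d2 = (LINT x:-A|lborel. \<bar>a x - b x\<bar>)"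
    have Zs: "a1 + a2 = Z" and Ws: "b1 + b2 = W" and Ds: "d1 + d2 = D"
      unfolding a1_def a2_def b1_def b2_def d1_def d2_def Z_def W_def D_def using a b A by (auto intro!: split)
    have le: "\<bar>a1 - b1\<bar> \<le> d1" "\<bar>a2 - b2\<bar> \<le> d2" "0 \<le> a1" "0 \<le> a2"
      unfolding a1_def a2_def b1_def b2_def d1_def d2_def using A by (auto intro!: diff nonneg)
    have d: "0 \<le> d1" "0 \<le> d2"
      using le by linarith+
    have "\<bar>a1 * W - b1 * Z\<bar> = \<bar>a1 * (b2 - a2) + a2 * (a1 - b1)\<bar>"
      unfolding Zs[symmetric] Ws[symmetric] by (simp add: algebra_simps)
    also have "\<dots> \<le> \<bar>a1 * (b2 - a2)\<bar> + \<bar>a2 * (a1 - b1)\<bar>"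
      by (rule abs_triangle_ineq)
    also have "\<dots> \<le> a1 * d2 + a2 * d1"
      unfolding abs_mult using le by (intro add_mono mult_mono) auto
    also have "\<dots> \<le> (a1 + a2) * (d1 + d2)"
      using le d by (simp add: algebra_simps)
    finally have *: "\<bar>a1 * W - b1 * Z\<bar> \<le> Z * D"
      by (simp only: Zs Ds)
    have "a1 / Z - b1 / W = (a1 * W - b1 * Z) / (Z * W)"
      using Z W by (simp add: field_simps)
    then have "\<bar>a1 / Z - b1 / W\<bar> = \<bar>a1 * W - b1 * Z\<bar> / (Z * W)"
      using Z W by (simp add: abs_mult)
    also have "\<dots> \<le> Z * D / (Z * W)"
      using * Z W by (intro divide_right_mono) auto
    also have "\<dots> = D / W"
      using Z by simp
    finally show ?thesis
      using a b A Z W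
      by (simp add: measure_normalized_density less_imp_le a1_def b1_def)
  qed
  then show ?thesis
    unfolding tv_dist_def D_def[symmetric] by (intro cSUP_least) auto
qed

text \<open>A mean value estimate, resting on 1 - exp (- r) \<le> r. The common lower bound
  \<open>m\<close> of the exponents later supplies the Gaussian majorant.\<close>

lemma exp_neg_diff_le:
  fixes p q m :: real
  assumes "m \<le> p" "m \<le> q"
  shows "\<bar>exp (- p) - exp (- q)\<bar> \<le> \<bar>p - q\<bar> * exp (- m)"
proof -
  have *: "exp (- p) - exp (- q) \<le> (q - p) * exp (- m)" if "p \<le> q" "m \<le> p" for p q
  proof -
    have "exp (- p) - exp (- q) = exp (- p) * (1 - exp (- (q - p)))"
      by (simp add: algebra_simps exp_add[symmetric])
    also have "\<dots> \<le> exp (- p) * (q - p)"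
    proof (rule mult_left_mono)
      show "1 - exp (- (q - p)) \<le> q - p"
        using exp_ge_add_one_self[of "- (q - p)"] by linarith
    qed simp
    also have "\<dots> \<le> exp (- m) * (q - p)"
      using that by (intro mult_right_mono) auto
    finally show ?thesis
      by (simp add: mult.commute)
  qed
  show ?thesis
    using *[of p q] *[of q p] assms by (cases "p \<le> q") auto
qed

text \<open>
  For \<open>t s \<le> 3/4\<close> the Taylor remainder is at most \<open>s\<^sup>2/4\<close>; for larger \<open>s\<close> both exponentials are
  small, and the factor \<open>(4 t s / 3)\<^sup>2 \<ge> 1\<close> turns this tail into a term of second order in \<open>t\<close>.
\<close>

lemma exp_taylor_remainder_bound:
  fixes p s t \<delta> :: real
  assumes s: "s \<ge> 0" and t: "t > 0" and \<delta>: "\<delta> \<le> 1"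
    and taylor: "\<bar>p - s\<^sup>2 / 2\<bar> \<le> t / 3 * s ^ 3" and low: "\<delta> / 2 * s\<^sup>2 \<le> p"
  shows "\<bar>exp (- p) - exp (- (1/2) * s\<^sup>2)\<bar> \<le>
    t / 3 * (s ^ 3 * exp (- (1/4) * s\<^sup>2)) + 16 / 9 * t\<^sup>2 * (s ^ 2 * exp (- (\<delta> / 2) * s\<^sup>2))"
    (is "?l \<le> ?r1 + ?r2")
proof -
  have r: "?r1 \<ge> 0" "?r2 \<ge> 0"
    using s t by simp_all
  show ?thesis
  proof (cases "t * s \<le> 3 / 4")
    case True
    then have "t / 3 * s \<le> 1 / 4"
      by simp
    then have "t / 3 * s * s\<^sup>2 \<le> 1 / 4 * s\<^sup>2"
      by (intro mult_right_mono) auto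
    then have "t / 3 * s ^ 3 \<le> 1 / 4 * s\<^sup>2"
      by (simp add: power3_eq_cube power2_eq_square mult.assoc)
    with taylor have "1 / 4 * s\<^sup>2 \<le> p"
      by linarith
    then have "?l \<le> \<bar>p - (1/2) * s\<^sup>2\<bar> * exp (- (1/4 * s\<^sup>2))"
      using exp_neg_diff_le[of "1/4 * s\<^sup>2" p "1/2 * s\<^sup>2"] by simp
    also have "\<dots> \<le> t / 3 * s ^ 3 * exp (- (1/4 * s\<^sup>2))"
      using taylor by (intro mult_right_mono) auto
    finally have "?l \<le> ?r1"
      by (simp only: mult.assoc mult_minus_left)
    then show ?thesis
      using r by linarith
  next
    case False
    define e where "e = exp (- (\<delta> / 2) * s\<^sup>2)"
    have "exp (- p) \<le> e"
      using low by (simp add: e_def)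
    moreover have "exp (- (1/2) * s\<^sup>2) \<le> e"
      using mult_right_mono[OF \<delta>, of "s\<^sup>2"] by (simp add: e_def)
    \<comment> \<open>Two numbers in the interval from 0 to \<open>e\<close> differ by at most
      \<open>e\<close>, so no factor 2 arises. That the Gaussian term also lies below
      \<open>e\<close> is due to \<delta> \<le> 1.\<close>
    ultimately have "?l \<le> e"
      by (simp add: abs_le_iff) (smt (verit) exp_gt_zero)
    also have "\<dots> \<le> (4 / 3 * (t * s))\<^sup>2 * e"
      using False by (simp add: e_def one_le_power)
    also have "\<dots> = ?r2"
      by (simp add: e_def power2_eq_square)
    finally show ?thesis
      using r by simp
  qed
qed

section \<open>Scaled covariances and the comparison of the two measures\<close>

lemma sym_pos_def_scaleR:
  assumes A: "sym_pos_def A" and c: "c > 0"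
  shows "sym_pos_def (c *\<^sub>R A)" "matrix_inv (c *\<^sub>R A) = inverse c *\<^sub>R matrix_inv A"
proof -
  show "sym_pos_def (c *\<^sub>R A)"
    using A c by (simp add: sym_pos_def_def transpose_scalar scaleR_matrix_vector_assoc[symmetric])
  have "(c *\<^sub>R A) ** (inverse c *\<^sub>R matrix_inv A) = mat 1"
    using sym_pos_def_inverse(1)[OF A] c by (simp add: scalar_matrix_assoc matrix_scalar_ac)
  then show "matrix_inv (c *\<^sub>R A) = inverse c *\<^sub>R matrix_inv A"
    by (rule matrix_inv_eqI)
qed

lemma wnorm_nonneg: "wnorm \<Sigma> x \<ge> 0"
  by (simp add: wnorm_def)

lemma wnorm_scaleR_left:
  assumes A: "sym_pos_def A" and c: "c > 0"
  shows "wnorm (c *\<^sub>R A) x = wnorm A x / sqrt c"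
proof (rule power2_eq_imp_eq)
  show "(wnorm (c *\<^sub>R A) x)\<^sup>2 = (wnorm A x / sqrt c)\<^sup>2"
    using c unfolding power_divide wnorm_squared[OF A] wnorm_squared[OF sym_pos_def_scaleR(1)[OF A c]]
      sym_pos_def_scaleR(2)[OF A c]
    by (simp add: scaleR_matrix_vector_assoc[symmetric] field_simps)
qed (use c in \<open>simp_all add: wnorm_nonneg\<close>)

text \<open>Brings the explicit normalization by the determinant into the form of a density divided
  by its integral, on which the total variation estimate operates.\<close>

lemma gaussian_eq:
  fixes A :: "real^'d^'d"
  assumes A: "sym_pos_def A"
  shows "gaussian m A = density lborel (\<lambda>x. ennreal (exp (- (1/2) * (wnorm A (x - m))\<^sup>2)
      / (LINT x|lborel. exp (- (1/2) * (wnorm A (x - m))\<^sup>2))))"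
    and "integrable lborel (\<lambda>x. exp (- (1/2) * (wnorm A (x - m))\<^sup>2))"
    and "(LINT x|lborel. exp (- (1/2) * (wnorm A (x - m))\<^sup>2)) = sqrt (det A) * sqrt (2 * pi) ^ CARD('d)"
proof -
  let ?f = "\<lambda>s::real. exp (- (1/2) * s\<^sup>2)"
  have int: "integrable lborel (\<lambda>u::real^'d. ?f (norm u))"
    by (rule integrable_gaussian) simp
  show "integrable lborel (\<lambda>x. ?f (wnorm A (x - m)))"
    by (rule integrable_wnorm[OF _ _ A int]) simp_all
  show Z: "(LINT x|lborel. ?f (wnorm A (x - m))) = sqrt (det A) * sqrt (2 * pi) ^ CARD('d)"
    by (subst integral_wnorm[where f="?f", OF _ _ A int])
      (simp_all add: integral_gaussian[of "1/2", where 'a="real^'d", simplified] mult.commute)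
  have "sqrt ((2 * pi) ^ CARD('d) * det A) = sqrt (det A) * sqrt (2 * pi) ^ CARD('d)"
    by (simp only: real_sqrt_mult real_sqrt_power mult.commute)
  then show "gaussian m A = density lborel (\<lambda>x. ennreal (?f (wnorm A (x - m))
      / (LINT x|lborel. ?f (wnorm A (x - m)))))"
    unfolding Z by (simp only: gaussian_def wnorm_squared[OF A])
qed

text \<open>With \<open>w\<close> the norm weighted by \<open>\<epsilon> *\<^sub>R \<Sigma>\<close>,
  the norm weighted by \<open>\<Sigma>\<close> is \<open>sqrt \<epsilon> * w\<close>. Dividing
  \<open>I\<close> by \<open>\<epsilon>\<close> therefore preserves the quadratic terms and turns
  the coefficient \<open>K\<close> of the cubic one into \<open>t\<close>. The factor
  \<open>sqrt (det A)\<close> of the radial integrals cancels with that of the Gaussian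
  constant.\<close>

lemma tv_dist_posterior_laplace:
  fixes I :: "real^'d \<Rightarrow> real"
  assumes cont: "continuous_on UNIV I" and \<epsilon>: "\<epsilon> > 0" and \<Sigma>: "sym_pos_def \<Sigma>" and K: "K > 0"
    and \<delta>: "\<delta> > 0" "\<delta> \<le> 1"
    and taylor: "\<And>x. \<bar>I x - (wnorm \<Sigma> (x - m))\<^sup>2 / 2\<bar> \<le> K / 3 * wnorm \<Sigma> (x - m) ^ 3"
    and low: "\<And>x. \<delta> / 2 * (wnorm \<Sigma> (x - m))\<^sup>2 \<le> I x"
  defines "t \<equiv> sqrt \<epsilon> * K"
  shows "tv_dist (posterior \<epsilon> I) (gaussian m (\<epsilon> *\<^sub>R \<Sigma>)) \<le>
    (t / 3 * (LINT u|lborel. norm (u::real^'d) ^ 3 * exp (- (1/4) * (norm u)\<^sup>2)) +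
     16 / 9 * t\<^sup>2 * (LINT u|lborel. norm (u::real^'d) ^ 2 * exp (- (\<delta> / 2) * (norm u)\<^sup>2)))
    / sqrt (2 * pi) ^ CARD('d)"
proof -
  define A where "A = \<epsilon> *\<^sub>R \<Sigma>"
  have A: "sym_pos_def A"
    unfolding A_def by (rule sym_pos_def_scaleR(1)[OF \<Sigma> \<epsilon>])
  define w where "w x = wnorm A (x - m)" for x
  have w: "w x \<ge> 0" for x
    by (simp add: w_def wnorm_nonneg)
  have w_eq: "wnorm \<Sigma> (x - m) = sqrt \<epsilon> * w x" for x
    using \<epsilon> by (simp add: w_def A_def wnorm_scaleR_left[OF \<Sigma> \<epsilon>])
  define p where "p x = I x / \<epsilon>" for x
  define a where "a x = exp (- p x)" for x
  define b where "b x = exp (- (1/2) * (w x)\<^sup>2)" for x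
  have t: "t > 0"
    using \<epsilon> K by (simp add: t_def)
  have p_taylor: "\<bar>p x - (w x)\<^sup>2 / 2\<bar> \<le> t / 3 * w x ^ 3" for x
  proof -
    have "\<epsilon> * \<bar>p x - (w x)\<^sup>2 / 2\<bar> = \<bar>\<epsilon> * (p x - (w x)\<^sup>2 / 2)\<bar>"
      using \<epsilon> by (simp add: abs_mult)
    also have "\<epsilon> * (p x - (w x)\<^sup>2 / 2) = I x - (wnorm \<Sigma> (x - m))\<^sup>2 / 2"
      using \<epsilon> by (simp add: w_eq p_def power_mult_distrib right_diff_distrib)
    also have "\<bar>\<dots>\<bar> \<le> K / 3 * (sqrt \<epsilon> * w x) ^ 3"
      using taylor[of x] by (simp add: w_eq)
    also have "\<dots> = \<epsilon> * (t / 3 * w x ^ 3)"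
      using \<epsilon> by (simp add: t_def power3_eq_cube)
    finally show ?thesis
      using \<epsilon> by simp
  qed
  have p_low: "\<delta> / 2 * (w x)\<^sup>2 \<le> p x" for x
    using low[of x] \<epsilon> by (simp add: w_eq p_def power_mult_distrib field_simps)
  define f3 f2 where "f3 s = s ^ 3 * exp (- (1/4) * s\<^sup>2)" and "f2 s = s ^ 2 * exp (- (\<delta> / 2) * s\<^sup>2)" for s :: real
  \<comment> \<open>The radial integration rules ask for nonnegativity on all reals, and a cube is
    negative on the left half-line. The absolute value repairs this without changing anything at
    norms.\<close>
  have int3: "integrable lborel (\<lambda>u::real^'d. \<bar>f3 (norm u)\<bar>)" and int2: "integrable lborel (\<lambda>u::real^'d. f2 (norm u))"
    unfolding f3_def f2_def using \<delta> by (intro integrable_abs integrable_norm_power_gaussian; simp)+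
  have [measurable]: "f3 \<in> borel_measurable borel" "f2 \<in> borel_measurable borel"
    unfolding f3_def f2_def by measurable
  have abs_f3: "\<bar>f3 (w x)\<bar> = f3 (w x)" "\<bar>f3 (norm u)\<bar> = f3 (norm u)" for x and u :: "real^'d"
    using w[of x] by (simp_all add: f3_def abs_mult)
  have f3: "integrable lborel (\<lambda>x. f3 (w x))"
      "(LINT x|lborel. f3 (w x)) = sqrt (det A) * (LINT u|lborel. f3 (norm (u::real^'d)))"
    using integrable_wnorm[where f="\<lambda>s. \<bar>f3 s\<bar>", OF _ _ A int3, of m]
      integral_wnorm[where f="\<lambda>s. \<bar>f3 s\<bar>", OF _ _ A int3, of m]
    by (simp_all add: abs_f3 w_def[symmetric])
  have f2_nonneg: "f2 s \<ge> 0" for s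
    by (simp add: f2_def)
  have f2: "integrable lborel (\<lambda>x. f2 (w x))"
      "(LINT x|lborel. f2 (w x)) = sqrt (det A) * (LINT u|lborel. f2 (norm (u::real^'d)))"
    using integrable_wnorm[OF _ f2_nonneg A int2, of m] integral_wnorm[OF _ f2_nonneg A int2, of m]
    by (simp_all add: w_def[symmetric])
  have [measurable]: "a \<in> borel_measurable lborel"
    unfolding a_def p_def using borel_measurable_continuous_onI[OF cont] by simp
  \<comment> \<open>The quadratic lower bound makes the unnormalized posterior density integrable by
    comparison.\<close>
  have int_low: "integrable lborel (\<lambda>x. exp (- (\<delta> / 2) * (w x)\<^sup>2))"
    unfolding w_def using \<delta> by (intro integrable_wnorm[OF _ _ A] integrable_gaussian) auto
  have int_a: "integrable lborel a"
    by (rule Bochner_Integration.integrable_bound[OF int_low]) (use p_low in \<open>auto simp: a_def\<close>)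
  have int_b: "integrable lborel b" and Zb: "(LINT x|lborel. b x) = sqrt (det A) * sqrt (2 * pi) ^ CARD('d)"
    and gauss: "gaussian m A = density lborel (\<lambda>x. ennreal (b x / (LINT x|lborel. b x)))"
    using gaussian_eq[OF A, of m] unfolding b_def w_def by auto
  have post: "posterior \<epsilon> I = density lborel (\<lambda>x. ennreal (a x / (LINT x|lborel. a x)))"
    by (simp add: posterior_def a_def p_def)
  have "(LINT x|lborel. \<bar>a x - b x\<bar>) \<le> (LINT x|lborel. t / 3 * f3 (w x) + 16 / 9 * t\<^sup>2 * f2 (w x))"
  proof (rule integral_mono)
    show "\<bar>a x - b x\<bar> \<le> t / 3 * f3 (w x) + 16 / 9 * t\<^sup>2 * f2 (w x)" for x
      unfolding a_def b_def f3_def f2_def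
      by (rule exp_taylor_remainder_bound[OF w t \<delta>(2) p_taylor p_low])
  qed (use int_a int_b f3(1) f2(1) in auto)
  also have "\<dots> = sqrt (det A) * (t / 3 * (LINT u|lborel. f3 (norm (u::real^'d))) + 16 / 9 * t\<^sup>2 * (LINT u|lborel. f2 (norm (u::real^'d))))"
    using f3 f2 by (simp add: algebra_simps)
  finally have diff: "(LINT x|lborel. \<bar>a x - b x\<bar>) \<le>
     sqrt (det A) * (t / 3 * (LINT u|lborel. f3 (norm (u::real^'d))) + 16 / 9 * t\<^sup>2 * (LINT u|lborel. f2 (norm (u::real^'d))))" .
  have "tv_dist (posterior \<epsilon> I) (gaussian m A) \<le> (LINT x|lborel. \<bar>a x - b x\<bar>) / (LINT x|lborel. b x)"
    unfolding post gauss by (rule tv_dist_normalized_densities[OF int_a _ int_b]) (simp_all add: a_def b_def)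
  also have "\<dots> \<le> sqrt (det A) * (t / 3 * (LINT u|lborel. f3 (norm (u::real^'d))) + 16 / 9 * t\<^sup>2 * (LINT u|lborel. f2 (norm (u::real^'d))))
     / (sqrt (det A) * sqrt (2 * pi) ^ CARD('d))"
    unfolding Zb using diff det_sym_pos_def[OF A] by (intro divide_right_mono) auto
  also have "\<dots> = (t / 3 * (LINT u|lborel. f3 (norm (u::real^'d))) + 16 / 9 * t\<^sup>2 * (LINT u|lborel. f2 (norm (u::real^'d))))
     / sqrt (2 * pi) ^ CARD('d)"
    using det_sym_pos_def[OF A] by simp
  finally show ?thesis
    unfolding A_def f3_def f2_def .
qed

theorem corollary4p4:
  shows "\<exists>C>0. \<forall>(G :: nat \<Rightarrow> real^'d \<Rightarrow> real^'d) (y :: nat \<Rightarrow> real^'d) (\<epsilon> :: nat \<Rightarrow> real)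
      (R :: nat \<Rightarrow> real^'d \<Rightarrow> real) (\<Phi> :: nat \<Rightarrow> real^'d \<Rightarrow> real) (I :: nat \<Rightarrow> real^'d \<Rightarrow> real)
      (xhat :: nat \<Rightarrow> real^'d) (\<Sigma> :: nat \<Rightarrow> real^'d^'d) (K :: nat \<Rightarrow> real) (\<delta> :: nat \<Rightarrow> real)
      (\<delta>\<^sub>0 :: real) (N\<^sub>0 :: nat).
      (\<forall>n. \<epsilon> n > 0) \<longrightarrow>
      (\<forall>n. is_prior_potential (R n)) \<longrightarrow>
      (\<forall>n. \<Phi> n = misfit (G n) (y n)) \<longrightarrow>
      (\<forall>n. unique_minimizer (\<lambda>x. \<Phi> n x + \<epsilon> n * R n x) (xhat n)) \<longrightarrow>
      (\<forall>n. I n = shifted_objective (\<epsilon> n) (\<Phi> n) (R n) (xhat n)) \<longrightarrow>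
      (\<forall>n. \<Sigma> n = matrix_inv (hessian (I n) (xhat n))) \<longrightarrow>
      (\<forall>n. C_class 3 (\<Phi> n) \<and> C_class 3 (R n) \<and> unique_minimizer (I n) (xhat n)
            \<and> sym_pos_def (hessian (I n) (xhat n))) \<longrightarrow>
      (\<forall>n. K n > 0 \<and>
            (\<forall>x. max (D3_wnorm (\<Sigma> n) (\<Phi> n) x) (D3_wnorm (\<Sigma> n) (R n) x) \<le> K n)) \<longrightarrow>
      (\<forall>n. 0 < \<delta> n \<and> \<delta> n \<le> 1 \<and>
            (\<forall>x. I n x \<ge> \<delta> n / 2 * (wnorm (\<Sigma> n) (x - xhat n))\<^sup>2)) \<longrightarrow>
      (\<lambda>n. sqrt (\<epsilon> n) * K n) \<longlonglongrightarrow> 0 \<longrightarrow>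
      \<delta>\<^sub>0 > 0 \<and> (\<forall>n\<ge>N\<^sub>0. \<delta> n \<ge> \<delta>\<^sub>0 \<and> \<epsilon> n \<le> 1) \<longrightarrow>
      (\<exists>N\<^sub>1\<ge>N\<^sub>0. \<forall>n\<ge>N\<^sub>1.
         tv_dist (posterior (\<epsilon> n) (I n)) (gaussian (xhat n) (\<epsilon> n *\<^sub>R \<Sigma> n))
           \<le> C * (sqrt (\<epsilon> n) * K n))"
proof -
  define c where "c = sqrt (2 * pi) ^ CARD('d)"
  define M3 where "M3 = (LINT u|lborel. norm (u::real^'d) ^ 3 * exp (- (1/4) * (norm u)\<^sup>2))"
  define M2 where "M2 \<delta> = (LINT u|lborel. norm (u::real^'d) ^ 2 * exp (- (\<delta> / 2) * (norm u)\<^sup>2))" for \<delta> :: real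
  have c: "c > 0"
    by (simp add: c_def)
  have "M3 \<ge> 0"
    unfolding M3_def by (intro integral_nonneg_AE) auto
  with c have C: "M3 / (3 * c) + 1 > 0"
    by (simp add: add_nonneg_pos)
  show ?thesis
  \<comment> \<open>The witness is fixed before any sequence and before
    \<open>\<delta>\<^sub>0\<close>; it involves only the dimension. \<open>M3 / (3 * c)\<close> is
    the coefficient of the first-order term, and the summand 1 pays for the second-order
    term.\<close>
  proof (intro exI[of _ "M3 / (3 * c) + 1"] conjI C allI impI, elim conjE)
    fix G :: "nat \<Rightarrow> real^'d \<Rightarrow> real^'d" and y xhat :: "nat \<Rightarrow> real^'d" and \<epsilon> K \<delta> :: "nat \<Rightarrow> real"
      and R \<Phi> I :: "nat \<Rightarrow> real^'d \<Rightarrow> real" and \<Sigma> :: "nat \<Rightarrow> real^'d^'d" and \<delta>\<^sub>0 :: real and N\<^sub>0 :: nat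
    assume \<epsilon>: "\<forall>n. \<epsilon> n > 0"
      and I: "\<forall>n. I n = shifted_objective (\<epsilon> n) (\<Phi> n) (R n) (xhat n)"
      and \<Sigma>: "\<forall>n. \<Sigma> n = matrix_inv (hessian (I n) (xhat n))"
      and reg: "\<forall>n. C_class 3 (\<Phi> n) \<and> C_class 3 (R n) \<and> unique_minimizer (I n) (xhat n)
            \<and> sym_pos_def (hessian (I n) (xhat n))"
      and K: "\<forall>n. K n > 0 \<and>
            (\<forall>x. max (D3_wnorm (\<Sigma> n) (\<Phi> n) x) (D3_wnorm (\<Sigma> n) (R n) x) \<le> K n)"
      and \<delta>: "\<forall>n. 0 < \<delta> n \<and> \<delta> n \<le> 1 \<and>
            (\<forall>x. I n x \<ge> \<delta> n / 2 * (wnorm (\<Sigma> n) (x - xhat n))\<^sup>2)"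
      and lim: "(\<lambda>n. sqrt (\<epsilon> n) * K n) \<longlonglongrightarrow> 0"
      and \<delta>0: "\<delta>\<^sub>0 > 0" and N0: "\<forall>n\<ge>N\<^sub>0. \<delta> n \<ge> \<delta>\<^sub>0 \<and> \<epsilon> n \<le> 1"
    have M2: "M2 \<delta>\<^sub>0 \<ge> 0"
      unfolding M2_def by (intro integral_nonneg_AE) auto
    \<comment> \<open>For \<open>t\<close> below this threshold,
      \<open>16 / 9 * M2 \<delta>\<^sub>0 * t\<close> is at most \<open>c\<close>, so the
      second-order term costs at most \<open>t\<close> after division by \<open>c\<close>. The added
      1 keeps the denominator positive. Only the starting index, not the constant, depends on
      \<open>\<delta>\<^sub>0\<close>.\<close>
    define \<eta> where "\<eta> = c / (16 / 9 * M2 \<delta>\<^sub>0 + 1)"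
    have "\<eta> > 0"
      using c M2 by (simp add: \<eta>_def add_nonneg_pos)
    from order_tendstoD(2)[OF lim this] obtain N where N: "\<And>n. n \<ge> N \<Longrightarrow> sqrt (\<epsilon> n) * K n < \<eta>"
      by (auto simp: eventually_sequentially)
    show "\<exists>N\<^sub>1\<ge>N\<^sub>0. \<forall>n\<ge>N\<^sub>1.
         tv_dist (posterior (\<epsilon> n) (I n)) (gaussian (xhat n) (\<epsilon> n *\<^sub>R \<Sigma> n))
           \<le> (M3 / (3 * c) + 1) * (sqrt (\<epsilon> n) * K n)"
    proof (intro exI[of _ "max N N\<^sub>0"] conjI allI impI)
      fix n assume n: "max N N\<^sub>0 \<le> n"
      define t where "t = sqrt (\<epsilon> n) * K n"
      have t: "t > 0" "t < \<eta>"
        using \<epsilon> K N[of n] n by (simp_all add: t_def)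
      have n0: "\<delta>\<^sub>0 \<le> \<delta> n" "\<epsilon> n \<le> 1"
        using N0 n by auto
      have Kn: "D3_wnorm (\<Sigma> n) (\<Phi> n) x \<le> K n" "D3_wnorm (\<Sigma> n) (R n) x \<le> K n" for x
        using K by (metis max.bounded_iff)+
      have min: "I n (xhat n) \<le> I n x" for x
        using reg unfolding unique_minimizer_def is_arg_min_def by (metis not_less)
      have C3: "C_class 3 (\<Phi> n)" "C_class 3 (R n)" and spd: "sym_pos_def (hessian (I n) (xhat n))"
        using reg by blast+
      note T = taylor_shifted_objective[of "\<Phi> n" "R n" "\<epsilon> n" "\<Sigma> n" "xhat n" "K n", folded I[rule_format],
          OF C3 \<epsilon>[rule_format] n0(2) \<Sigma>[rule_format] spd min Kn]
      have Kpos: "K n > 0"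
        using K by blast
      \<comment> \<open>Replacing \<open>\<delta> n\<close> by its lower bound makes the moment
        \<open>M2 \<delta>\<^sub>0\<close> the same for all \<open>n\<close>.\<close>
      have low: "\<delta>\<^sub>0 / 2 * (wnorm (\<Sigma> n) (x - xhat n))\<^sup>2 \<le> I n x" for x
      proof -
        have "\<delta>\<^sub>0 / 2 * (wnorm (\<Sigma> n) (x - xhat n))\<^sup>2 \<le> \<delta> n / 2 * (wnorm (\<Sigma> n) (x - xhat n))\<^sup>2"
          using n0(1) by (intro mult_right_mono) auto
        also have "\<dots> \<le> I n x"
          using \<delta> by blast
        finally show ?thesis .
      qed
      have \<delta>1: "\<delta>\<^sub>0 \<le> 1"
        using n0(1) \<delta> by (metis order_trans)
      have cont: "continuous_on UNIV (I n)"
        using C_class_mono[OF T(1)[OF Kpos], of 0] by simp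
      have "tv_dist (posterior (\<epsilon> n) (I n)) (gaussian (xhat n) (\<epsilon> n *\<^sub>R \<Sigma> n)) \<le>
          (t / 3 * M3 + 16 / 9 * t\<^sup>2 * M2 \<delta>\<^sub>0) / c"
        unfolding t_def M3_def M2_def c_def
        by (rule tv_dist_posterior_laplace[OF cont \<epsilon>[rule_format] T(2)[OF Kpos] Kpos \<delta>0 \<delta>1 T(3)[OF Kpos] low])
      also have "\<dots> \<le> (t / 3 * M3 + t * c) / c"
      proof -
        have "16 / 9 * M2 \<delta>\<^sub>0 * t \<le> (16 / 9 * M2 \<delta>\<^sub>0 + 1) * \<eta>"
          using t M2 by (intro mult_mono) auto
        also have "\<dots> = c"
          using M2 by (simp add: \<eta>_def add_nonneg_pos less_imp_neq[symmetric])
        finally have "t * (16 / 9 * M2 \<delta>\<^sub>0 * t) \<le> t * c"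
          using t by (intro mult_left_mono) auto
        then show ?thesis
          using c by (intro divide_right_mono) (auto simp: power2_eq_square mult_ac)
      qed
      also have "\<dots> = (M3 / (3 * c) + 1) * t"
        using c by (simp add: field_simps)
      finally show "tv_dist (posterior (\<epsilon> n) (I n)) (gaussian (xhat n) (\<epsilon> n *\<^sub>R \<Sigma> n))
           \<le> (M3 / (3 * c) + 1) * (sqrt (\<epsilon> n) * K n)"
        by (simp only: t_def)
    qed simp
  qed
qed

end
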